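(* Let $\mathcal{S}$ be a finite or countable set, let $p$ be an irreducible and recurrent transition matrix on $\mathcal{S}$ with stationary measure $(m_j)_{j\in\mathcal{S}}$, and let $X=(X_n)_{n\in\mathbb{Z}}$ be the two-sided Markov chain with transition matrix $p$ and initial state $X_0=i$. Let $\nu=(\nu_j)_{j\in\mathcal{S}}$ be a probability measure on $\mathcal{S}$ such that $\nu_i=0$ and $\frac{m_i}{m_j}\nu_j\in\mathbb{Z}$ for all $j\in\mathcal{S}$. Let $$T_*:=\min\Big\{n\ge 0\colon L^i([0,n])\le\sum_{j\in\mathcal{S}}\nu_j\,L^j([0,n])\Big\},$$ and let $T$ be any non-negative, possibly randomized, solution of the Skorokhod embedding problem for $X$ with target $\nu$, i.e. a (possibly randomized) random time $T\ge0$ such that $(X_{n+T})_{n\in\mathbb{Z}}$ is a two-sided Markov chain with transition matrix $p$ and $X_T$ has law $\nu$. Then $$\mathbb{E}_i\big[\psi(T_* )\big]\le\mathbb{E}_i^{\oplus}\big[\psi(T)\big]$$ for any non-negative concave function $\psi$ defined on the non-negative integers, where the expectation $\mathbb{E}_i^\oplus$ on the right is with respect to the chain as well as any possible extra randomness used to define $T$.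
   Context: An irreducible and recurrent transition matrix $p$ on a finite or countable set $\mathcal{S}$ has a stationary measure $(m_j)_{j\in\mathcal{S}}$ with strictly positive weights, unique up to a positive multiple. The dual transition matrix is $p^*_{jk}=(m_k/m_j)\,p_{kj}$. The two-sided Markov chain with transition matrix $p$ and initial distribution $\nu$ is the process $(X_n)_{n\in\mathbb{Z}}$ such that $X_0$ has law $\nu$ and, given $X_0$, the processes $(X_n)_{n\ge0}$ and $(X_{-n})_{n\ge0}$ are independent Markov chains started in $X_0$ with transition matrices $p$ and $p^*$, respectively. Its law on $\Omega=\mathcal{S}^{\mathbb{Z}}$ is denoted $\mathbb{P}_\nu$; $\mathbb{P}_i=\mathbb{P}_{\delta_i}$, with expectation $\mathbb{E}_i$. The local time at $j\in\mathcal{S}$ is $L^j(A)=\frac1{m_j}\#\{n\in A\colon X_n=j\}$ for $A\subset\mathbb{Z}$; intervals are intervals of integers. A (possibly randomized) random time is given by a measurable space $\Omega'$, a measurable family $(\mathbb{Q}_\omega)_{\omega\in\Omega}$ of probability measures on $\Omega'$ (a probability kernel), and a measurable map $T\colon\Omega\times\Omega'\to\mathbb{Z}$. One sets $\mathbb{P}_i^\oplus(d\omega\,d\omega')=\mathbb{P}_i(d\omega)\,\mathbb{Q}_\omega(d\omega')$ with expectation $\mathbb{E}_i^\oplus$. That $T$ is a solution means that under $\mathbb{P}_i^\oplus$ the process $(X_{n+T})_{n\in\mathbb{Z}}$ has law $\mathbb{P}_\nu$. *)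

theory Defs
  imports "HOL-Probability.Probability"
begin

definition transition_matrix :: "('s \<Rightarrow> 's \<Rightarrow> real) \<Rightarrow> bool" where
  "transition_matrix p \<longleftrightarrow> (\<forall>j k. 0 \<le> p j k) \<and> (\<forall>j. (p j has_sum 1) UNIV)"

primrec n_step :: "('s \<Rightarrow> 's \<Rightarrow> real) \<Rightarrow> nat \<Rightarrow> 's \<Rightarrow> 's \<Rightarrow> real" where
  "n_step p 0 j k = (if j = k then 1 else 0)"
| "n_step p (Suc n) j k = (\<Sum>\<^sub>\<infinity>l\<in>UNIV. p j l * n_step p n l k)"

definition irreducible_matrix :: "('s \<Rightarrow> 's \<Rightarrow> real) \<Rightarrow> bool" where
  "irreducible_matrix p \<longleftrightarrow> (\<forall>j k. \<exists>n. 0 < n_step p n j k)"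

text \<open>The probability, for the chain started in \<open>j\<close>, that the first visit to \<open>k\<close> at a
  strictly positive time happens at time \<open>n + 1\<close>. Recurrence says that these return
  probabilities (case \<open>j = k\<close>) add up to one, so the chain returns almost surely.\<close>

primrec first_passage :: "('s \<Rightarrow> 's \<Rightarrow> real) \<Rightarrow> nat \<Rightarrow> 's \<Rightarrow> 's \<Rightarrow> real" where
  "first_passage p 0 j k = p j k"
| "first_passage p (Suc n) j k = (\<Sum>\<^sub>\<infinity>l\<in>- {k}. p j l * first_passage p n l k)"

definition recurrent_matrix :: "('s \<Rightarrow> 's \<Rightarrow> real) \<Rightarrow> bool" where
  "recurrent_matrix p \<longleftrightarrow> (\<forall>j. (\<lambda>n. first_passage p n j j) sums 1)"

definition stationary_measure :: "('s \<Rightarrow> 's \<Rightarrow> real) \<Rightarrow> ('s \<Rightarrow> real) \<Rightarrow> bool" where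
  "stationary_measure p m \<longleftrightarrow>
     (\<forall>j. 0 < m j) \<and> (\<forall>k. ((\<lambda>j. m j * p j k) has_sum m k) UNIV)"

definition dual_matrix :: "('s \<Rightarrow> real) \<Rightarrow> ('s \<Rightarrow> 's \<Rightarrow> real) \<Rightarrow> 's \<Rightarrow> 's \<Rightarrow> real" where
  "dual_matrix m p j k = m k / m j * p k j"

text \<open>The last clause is the Markov property given the whole past, with the
  conditional probability multiplied out.\<close>

definition markov_chain ::
    "('s \<Rightarrow> 's \<Rightarrow> real) \<Rightarrow> 's \<Rightarrow> 'w measure \<Rightarrow> (nat \<Rightarrow> 'w \<Rightarrow> 's) \<Rightarrow> bool" where
  "markov_chain p i M Y \<longleftrightarrow>
     prob_space M \<and>
     (\<forall>n. Y n \<in> M \<rightarrow>\<^sub>M count_space UNIV) \<and>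
     (AE \<omega> in M. Y 0 \<omega> = i) \<and>
     (\<forall>n x. measure M {\<omega> \<in> space M. \<forall>k\<le>Suc n. Y k \<omega> = x k} =
            measure M {\<omega> \<in> space M. \<forall>k\<le>n. Y k \<omega> = x k} * p (x n) (x (Suc n)))"

text \<open>Conditioning on \<open>X 0\<close> means passing to the elementary conditional measure given
  \<open>X 0 = i\<close>, for every state \<open>i\<close> charged by the initial distribution.\<close>

definition two_sided_markov_chain ::
    "('s::countable \<Rightarrow> 's \<Rightarrow> real) \<Rightarrow> ('s \<Rightarrow> real) \<Rightarrow> 's pmf \<Rightarrow> 'w measure \<Rightarrow> (int \<Rightarrow> 'w \<Rightarrow> 's) \<Rightarrow> bool"
  where
  "two_sided_markov_chain p m \<nu> M X \<longleftrightarrow>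
     prob_space M \<and>
     (\<forall>n. X n \<in> M \<rightarrow>\<^sub>M count_space UNIV) \<and>
     distr M (count_space UNIV) (X 0) = measure_pmf \<nu> \<and>
     (\<forall>i \<in> set_pmf \<nu>.
        let Mi = uniform_measure M {\<omega> \<in> space M. X 0 \<omega> = i};
            S = (\<Pi>\<^sub>M (n::nat)\<in>UNIV. count_space (UNIV :: 's set))
        in markov_chain p i Mi (\<lambda>n. X (int n)) \<and>
           markov_chain (dual_matrix m p) i Mi (\<lambda>n. X (- int n)) \<and>
           prob_space.indep_var Mi S (\<lambda>\<omega> n. X (int n) \<omega>) S (\<lambda>\<omega> n. X (- int n) \<omega>))"

definition path_space :: "(int \<Rightarrow> 's::countable) measure" where
  "path_space = (\<Pi>\<^sub>M (n::int)\<in>UNIV. count_space (UNIV :: 's set))"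

text \<open>Only meant for finite \<open>A\<close>, since \<open>card\<close> is zero on infinite sets.\<close>

definition local_time :: "('s \<Rightarrow> real) \<Rightarrow> (int \<Rightarrow> 's) \<Rightarrow> 's \<Rightarrow> int set \<Rightarrow> real" where
  "local_time m x j A = real (card {n \<in> A. x n = j}) / m j"

text \<open>Only finitely many terms of the sum are nonzero. For a recurrent chain started in \<open>i\<close>
  and admissible \<open>\<nu>\<close>, the set whose minimum is taken is empty only on a null event,
  where the value is unspecified.\<close>

definition T_star :: "('s \<Rightarrow> real) \<Rightarrow> 's pmf \<Rightarrow> 's \<Rightarrow> (int \<Rightarrow> 's) \<Rightarrow> nat" where
  "T_star m \<nu> i x =
     (LEAST n. local_time m x i {0..int n} \<le> (\<Sum>\<^sub>\<infinity>j\<in>UNIV. pmf \<nu> j * local_time m x j {0..int n}))"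

text \<open>The measure \<open>P(d\<omega>) Q\<^sub>\<omega>(d\<omega>')\<close> on the product of the path space and the space of extra
  randomness.\<close>

definition extended_law ::
    "(int \<Rightarrow> 's::countable) measure \<Rightarrow> 'r measure \<Rightarrow> ((int \<Rightarrow> 's) \<Rightarrow> 'r measure) \<Rightarrow>
     ((int \<Rightarrow> 's) \<times> 'r) measure" where
  "extended_law P R Q = P \<bind> (\<lambda>\<omega>. distr (Q \<omega>) (path_space \<Otimes>\<^sub>M R) (Pair \<omega>))"

text \<open>The concavity inequality at all convex combinations of naturals that are naturals.\<close>

definition concave_nat :: "(nat \<Rightarrow> real) \<Rightarrow> bool" where
  "concave_nat \<psi> \<longleftrightarrow>
     (\<forall>a b c t. 0 \<le> t \<and> t \<le> 1 \<and> real c = (1 - t) * real a + t * real b \<longrightarrow>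
        (1 - t) * \<psi> a + t * \<psi> b \<le> \<psi> c)"

end

theory Submission imports Defs begin

text \<open>Call the visits to \<open>i\<close> sources of mass one, and let a site in state \<open>j\<close> absorb mass
  \<open>a j = m i / m j * pmf \<nu> j\<close>. Under the two-sided chain, a solution \<open>T\<close> moves the mass of every source
  forward in time, the source at \<open>x\<close> sending mass according to the law of \<open>T\<close> given the path seen
  from \<open>x\<close>; as the shifted path has the law with initial distribution \<open>\<nu>\<close>, almost surely no site
  receives more than it absorbs. \<open>T_star\<close> is the last-in-first-out matching.

  For \<open>x \<le> y\<close> the cost \<open>min k (y - x)\<close> is the number of integer windows of length \<open>k\<close> that contain
  \<open>x\<close> but end before \<open>y\<close>. In every fixed window the last-in-first-out matching leaves the
  least possible amount of source mass unmatched, since after its first unmatched source it uses all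
  the absorbing capacity of the window. Integrating over windows gives the claim for
  \<open>\<psi> n = min n k\<close>, and with it the almost sure finiteness of \<open>T_star\<close>; a general nonnegative concave
  \<open>\<psi>\<close> is handled by summation by parts.\<close>

section \<open>Cylinder probabilities of the two-sided chain\<close>

lemma markov_chain_cylinder:
  assumes "markov_chain p i M Y"
  shows "measure M {\<omega> \<in> space M. \<forall>k\<le>n. Y k \<omega> = x k} = of_bool (x 0 = i) * (\<Prod>k<n. p (x k) (x (Suc k)))"
proof (induction n)
  case 0
  interpret prob_space M using assms by (simp add: markov_chain_def)
  have m: "Y 0 \<in> M \<rightarrow>\<^sub>M count_space UNIV" and ae: "AE \<omega> in M. Y 0 \<omega> = i"
    using assms by (auto simp: markov_chain_def)
  have ms: "{\<omega> \<in> space M. Y 0 \<omega> = x 0} \<in> events"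
    using measurable_sets[OF m, of "{x 0}"] by (simp add: vimage_def Int_def conj_commute)
  have "measure M {\<omega> \<in> space M. Y 0 \<omega> = x 0} = (if x 0 = i then 1 else 0)"
  proof (cases "x 0 = i")
    case True
    then show ?thesis using ae ms prob_Collect_eq_1 by auto
  next
    case False
    then have "AE \<omega> in M. Y 0 \<omega> \<noteq> x 0" using ae by auto
    then have "measure M {\<omega> \<in> space M. Y 0 \<omega> = x 0} = measure M {}"
      by (intro measure_eq_AE) (use ms in auto)
    then show ?thesis using False by simp
  qed
  then show ?case by simp
next
  case (Suc n)
  then show ?case using assms by (simp add: markov_chain_def)
qed

text \<open>The factors \<open>m (y (Suc k)) / m (y k)\<close> telescope, so a path weighs as much
  under the dual matrix as its time reversal under \<open>p\<close>, up to the ratio of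
  \<open>m\<close> at the two ends.\<close>

lemma prod_dual_matrix:
  assumes "\<And>j. 0 < m j"
  shows "(\<Prod>k<n. dual_matrix m p (y k) (y (Suc k))) = m (y n) / m (y 0) * (\<Prod>k<n. p (y (Suc k)) (y k))"
proof (induction n)
  case 0
  then show ?case using assms[of "y 0"] by simp
next
  case (Suc n)
  then show ?case using assms[of "y n"] by (simp add: dual_matrix_def)
qed

text \<open>The index \<open>k\<close> stands for the edge from \<open>k\<close> to
  \<open>k + 1\<close>; the edge \<open>- int (Suc k)\<close> is the one that the backward chain
  crosses between its times \<open>k\<close> and \<open>Suc k\<close>.\<close>

lemma prod_two_sided:
  fixes f :: "int \<Rightarrow> 'a::comm_monoid_mult"
  shows "(\<Prod>k\<in>{- int a..<int b}. f k) = (\<Prod>k<b. f (int k)) * (\<Prod>k<a. f (- int (Suc k)))"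
proof -
  have "{- int a..<int b} = int ` {..<b} \<union> (\<lambda>k. - int (Suc k)) ` {..<a}"
  proof (intro set_eqI iffI)
    fix k assume "k \<in> {- int a..<int b}"
    then show "k \<in> int ` {..<b} \<union> (\<lambda>k. - int (Suc k)) ` {..<a}"
      by (cases k rule: int_cases) auto
  qed auto
  moreover have "int ` {..<b} \<inter> (\<lambda>k. - int (Suc k)) ` {..<a} = {}" by auto
  ultimately have "(\<Prod>k\<in>{- int a..<int b}. f k) =
      (\<Prod>k\<in>int ` {..<b}. f k) * (\<Prod>k\<in>(\<lambda>k. - int (Suc k)) ` {..<a}. f k)"
    by (simp add: prod.union_disjoint)
  also have "(\<Prod>k\<in>int ` {..<b}. f k) = (\<Prod>k<b. f (int k))"
    by (simp add: prod.reindex)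
  also have "(\<Prod>k\<in>(\<lambda>k. - int (Suc k)) ` {..<a}. f k) = (\<Prod>k<a. f (- int (Suc k)))"
    by (subst prod.reindex) (auto simp: inj_on_def)
  finally show ?thesis .
qed

lemma
  assumes "two_sided_markov_chain p m \<nu> M X"
  shows two_sided_markov_chain_prob_space: "prob_space M"
    and two_sided_markov_chain_measurable: "X n \<in> M \<rightarrow>\<^sub>M count_space UNIV"
    and two_sided_markov_chain_law: "distr M (count_space UNIV) (X 0) = measure_pmf \<nu>"
  using assms unfolding two_sided_markov_chain_def by blast+

text \<open>Given \<open>X 0\<close>, independence multiplies the forward and backward products, and
  duality merges them into one product over all edges of the window. The result is the weight under
  the stationary law, tilted by \<open>pmf \<nu> (x 0) / m (x 0)\<close>; the initial law enters
  through this factor alone, which makes laws with different origins comparable.\<close>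

lemma two_sided_markov_chain_cylinder:
  fixes p :: "'s::countable \<Rightarrow> 's \<Rightarrow> real"
  assumes chain: "two_sided_markov_chain p m \<nu> M X" and m: "\<And>j. 0 < m j"
  shows "measure M {\<omega> \<in> space M. \<forall>k\<in>{- int a..int b}. X k \<omega> = x k} =
    pmf \<nu> (x 0) / m (x 0) * m (x (- int a)) * (\<Prod>k\<in>{- int a..<int b}. p (x k) (x (k + 1)))"
    (is "measure M ?C = _")
proof -
  interpret prob_space M using chain by (rule two_sided_markov_chain_prob_space)
  have X[measurable]: "X n \<in> M \<rightarrow>\<^sub>M count_space UNIV" for n
    using chain by (rule two_sided_markov_chain_measurable)
  have law: "distr M (count_space UNIV) (X 0) = measure_pmf \<nu>"
    using chain by (rule two_sided_markov_chain_law)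
  define B where "B = {\<omega> \<in> space M. X 0 \<omega> = x 0}"
  have B[measurable]: "B \<in> events" unfolding B_def by measurable
  have "measure (distr M (count_space UNIV) (X 0)) {x 0} = measure M B"
    by (subst measure_distr) (auto simp: B_def vimage_def Int_def conj_commute)
  then have PB: "measure M B = pmf \<nu> (x 0)" by (simp add: law measure_pmf_single)
  have CB: "?C \<subseteq> B" by (auto simp: B_def)
  show ?thesis
  proof (cases "x 0 \<in> set_pmf \<nu>")
    \<comment> \<open>Nothing is known about the conditional chain in a state that
      \<open>\<nu>\<close> does not charge, but then both sides vanish.\<close>
    case False
    then have "measure M B = 0" using PB by (simp add: set_pmf_iff)
    moreover have "measure M ?C \<le> measure M B" using CB B by (rule finite_measure_mono)
    ultimately show ?thesis using False by (simp add: set_pmf_iff measure_le_0_iff)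
  next
    case True
    then have pos: "0 < measure M B" using PB by (simp add: pmf_positive)
    define N where "N = uniform_measure M B"
    define S where "S = (\<Pi>\<^sub>M (n::nat)\<in>UNIV. count_space (UNIV :: 's set))"
    have fwd: "markov_chain p (x 0) N (\<lambda>n. X (int n))"
      and bwd: "markov_chain (dual_matrix m p) (x 0) N (\<lambda>n. X (- int n))"
      and ind: "prob_space.indep_var N S (\<lambda>\<omega> n. X (int n) \<omega>) S (\<lambda>\<omega> n. X (- int n) \<omega>)"
      using chain True unfolding two_sided_markov_chain_def Let_def N_def B_def S_def by auto
    interpret N: prob_space N using fwd by (simp add: markov_chain_def)
    have spN: "space N = space M" by (simp add: N_def)
    \<comment> \<open>Both events fix coordinate 0. This costs nothing under the conditional law,
      where both chains start in \<open>x 0\<close>.\<close>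
    define F where "F = {f::nat \<Rightarrow> 's. \<forall>k\<le>b. f k = x (int k)}"
    define G where "G = {f::nat \<Rightarrow> 's. \<forall>k\<le>a. f k = x (- int k)}"
    have spS: "space S = UNIV" by (simp add: S_def space_PiM)
    have F: "F \<in> sets S"
    proof -
      have "Measurable.pred S (\<lambda>f. \<forall>k\<le>b. f k = x (int k))"
        unfolding S_def by measurable
      then show ?thesis by (simp add: pred_def F_def spS)
    qed
    have G: "G \<in> sets S"
    proof -
      have "Measurable.pred S (\<lambda>f. \<forall>k\<le>a. f k = x (- int k))"
        unfolding S_def by measurable
      then show ?thesis by (simp add: pred_def G_def spS)
    qed
    have "?C = (\<lambda>\<omega>. (\<lambda>n. X (int n) \<omega>, \<lambda>n. X (- int n) \<omega>)) -` (F \<times> G) \<inter> space N"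
    proof (intro set_eqI iffI)
      fix \<omega> assume *: "\<omega> \<in> (\<lambda>\<omega>. (\<lambda>n. X (int n) \<omega>, \<lambda>n. X (- int n) \<omega>)) -` (F \<times> G) \<inter> space N"
      have "X k \<omega> = x k" if "k \<in> {- int a..int b}" for k
      proof (cases "k \<ge> 0")
        case True
        then obtain n where "k = int n" by (metis nonneg_int_cases)
        then show ?thesis using * that by (auto simp: F_def)
      next
        case False
        then obtain n where "k = - int n" by (intro that[of "nat (- k)"]) simp
        then show ?thesis using * that by (auto simp: G_def)
      qed
      then show "\<omega> \<in> ?C" using * spN by auto
    qed (auto simp: F_def G_def spN)
    moreover have "measure N ((\<lambda>\<omega>. (\<lambda>n. X (int n) \<omega>, \<lambda>n. X (- int n) \<omega>)) -` (F \<times> G) \<inter> space N) =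
        measure N ((\<lambda>\<omega> n. X (int n) \<omega>) -` F \<inter> space N) * measure N ((\<lambda>\<omega> n. X (- int n) \<omega>) -` G \<inter> space N)"
      by (rule N.indep_varD[OF ind F G])
    moreover have "(\<lambda>\<omega> n. X (int n) \<omega>) -` F \<inter> space N = {\<omega> \<in> space N. \<forall>k\<le>b. X (int k) \<omega> = x (int k)}"
      by (auto simp: F_def)
    moreover have "(\<lambda>\<omega> n. X (- int n) \<omega>) -` G \<inter> space N = {\<omega> \<in> space N. \<forall>k\<le>a. X (- int k) \<omega> = x (- int k)}"
      by (auto simp: G_def)
    ultimately have "measure N ?C = (\<Prod>k<b. p (x (int k)) (x (int (Suc k)))) *
        (\<Prod>k<a. dual_matrix m p (x (- int k)) (x (- int (Suc k))))"
      using markov_chain_cylinder[OF fwd, of b "\<lambda>k. x (int k)"]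
        markov_chain_cylinder[OF bwd, of a "\<lambda>k. x (- int k)"] by simp
    also have "\<dots> = (\<Prod>k<b. p (x (int k)) (x (int (Suc k)))) * (m (x (- int a)) / m (x 0) *
        (\<Prod>k<a. p (x (- int (Suc k))) (x (- int k))))"
      using prod_dual_matrix[where m=m and p=p and n=a and y="\<lambda>k. x (- int k)"] m by simp
    also have "\<dots> = m (x (- int a)) / m (x 0) * (\<Prod>k\<in>{- int a..<int b}. p (x k) (x (k + 1)))"
      by (simp add: prod_two_sided algebra_simps)
    finally have N1: "measure N ?C = m (x (- int a)) / m (x 0) * (\<Prod>k\<in>{- int a..<int b}. p (x k) (x (k + 1)))" .
    have Cm: "?C \<in> events" by measurable
    have "measure N ?C = measure M ?C / measure M B"
    proof -
      have "measure N ?C = measure M (B \<inter> ?C) / measure M B"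
        unfolding N_def by (rule measure_uniform_measure) (use pos Cm in \<open>auto simp: emeasure_eq_measure\<close>)
      then show ?thesis using CB by (simp add: Int_absorb1)
    qed
    then show ?thesis using N1 pos PB by (simp add: field_simps)
  qed
qed

section \<open>Path space and change of origin\<close>

text \<open>This is \<open>m i\<close> times the tilt factor of the cylinder probabilities. For
  \<open>\<nu> = return_pmf i\<close> and positive \<open>m\<close> it is the indicator of
  \<open>i\<close>.\<close>

definition site_weight :: "('s \<Rightarrow> real) \<Rightarrow> 's pmf \<Rightarrow> 's \<Rightarrow> 's \<Rightarrow> real" where
  "site_weight m \<nu> i j = m i / m j * pmf \<nu> j"

lemma space_path_space [simp]: "space path_space = UNIV"
  by (simp add: path_space_def space_PiM)

lemma UNIV_in_sets_path_space [simp]: "UNIV \<in> sets path_space"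
  by (metis sets.top space_path_space)

lemma measurable_path_component [measurable (raw)]:
  "(\<lambda>\<omega>. \<omega> k) \<in> path_space \<rightarrow>\<^sub>M count_space UNIV"
  unfolding path_space_def by measurable

lemma measurable_into_path_space:
  assumes "\<And>n. X n \<in> M \<rightarrow>\<^sub>M count_space UNIV"
  shows "(\<lambda>z n. X n z) \<in> M \<rightarrow>\<^sub>M path_space"
  unfolding path_space_def by (rule measurable_PiM_single') (use assms in auto)

lemma measurable_path_shift [measurable]: "(\<lambda>\<omega> n. \<omega> (n + l)) \<in> path_space \<rightarrow>\<^sub>M path_space"
  by (rule measurable_into_path_space) (rule measurable_path_component)

text \<open>The state space is countable, so each finite-dimensional event is a countable disjoint
  union of cylinders that fix every coordinate of a large symmetric window. The bound
  \<open>n0\<close> lets a user assume that the window contains a prescribed coordinate.\<close>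

lemma path_space_measure_eqI:
  fixes A B :: "(int \<Rightarrow> 's::countable) measure"
  assumes A: "sets A = sets path_space" and B: "sets B = sets path_space" and fin: "finite_measure A"
    and eq: "\<And>n x. n \<ge> n0 \<Longrightarrow> emeasure A {\<omega>. \<forall>k\<in>{- int n..int n}. \<omega> k = x k} =
      emeasure B {\<omega>. \<forall>k\<in>{- int n..int n}. \<omega> k = x k}"
  shows "A = B"
proof (rule measure_eqI_PiM_infinite[OF _ _ _ fin])
  show "sets A = sets (\<Pi>\<^sub>M (n::int)\<in>UNIV. count_space (UNIV :: 's set))"
    and "sets B = sets (\<Pi>\<^sub>M (n::int)\<in>UNIV. count_space (UNIV :: 's set))"
    using A B by (simp_all add: path_space_def)
  fix E :: "int \<Rightarrow> 's set" and J :: "int set"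
  assume J: "finite J"
  define n where "n = max n0 (nat (Max (insert 0 (abs ` J))))"
  define I where "I = {- int n..int n}"
  have JI: "J \<subseteq> I"
  proof
    fix j assume "j \<in> J"
    then have "\<bar>j\<bar> \<le> Max (insert 0 (abs ` J))" using J by (intro Max_ge) auto
    then have "\<bar>j\<bar> \<le> int n" by (simp add: n_def)
    then show "j \<in> I" by (simp add: I_def abs_le_iff)
  qed
  \<comment> \<open>Coordinates of the window outside \<open>J\<close> are left free.\<close>
  define E' where "E' k = (if k \<in> J then E k else UNIV)" for k
  define cyl where "cyl x = {\<omega>::int \<Rightarrow> 's. \<forall>k\<in>I. \<omega> k = x k}" for x
  let ?emb = "prod_emb UNIV (\<lambda>_. count_space UNIV) J (Pi\<^sub>E J E)"
  have emb: "?emb = (\<Union>x\<in>Pi\<^sub>E I E'. cyl x)"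
  proof (intro set_eqI iffI)
    fix \<omega> assume "\<omega> \<in> ?emb"
    then have *: "\<omega> j \<in> E j" if "j \<in> J" for j using that by (auto simp: prod_emb_iff PiE_iff)
    have "restrict \<omega> I \<in> Pi\<^sub>E I E'" using * by (auto simp: E'_def)
    moreover have "\<omega> \<in> cyl (restrict \<omega> I)" by (simp add: cyl_def)
    ultimately show "\<omega> \<in> (\<Union>x\<in>Pi\<^sub>E I E'. cyl x)" by blast
  next
    fix \<omega> assume "\<omega> \<in> (\<Union>x\<in>Pi\<^sub>E I E'. cyl x)"
    then obtain x where x: "x \<in> Pi\<^sub>E I E'" "\<omega> \<in> cyl x" by blast
    have "\<omega> j \<in> E j" if "j \<in> J" for j
    proof -
      have "x j \<in> E' j" using x JI that by (auto simp: PiE_iff)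
      then show ?thesis using x JI that by (auto simp: cyl_def E'_def)
    qed
    then show "\<omega> \<in> ?emb" by (auto simp: prod_emb_iff PiE_iff)
  qed
  have cnt: "countable (Pi\<^sub>E I E')" by (rule countable_PiE) (auto simp: I_def)
  have disj: "disjoint_family_on cyl (Pi\<^sub>E I E')"
    by (auto simp: disjoint_family_on_def cyl_def PiE_iff extensional_def fun_eq_iff) metis
  have cyl: "cyl x \<in> sets path_space" for x
  proof -
    have "Measurable.pred path_space (\<lambda>\<omega>. \<forall>k\<in>I. \<omega> k = x k)" unfolding I_def by measurable
    then show ?thesis by (simp add: pred_def cyl_def)
  qed
  have "emeasure A (cyl x) = emeasure B (cyl x)" for x
    using eq[of n x] by (simp add: cyl_def I_def n_def)
  then show "emeasure A ?emb = emeasure B ?emb"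
    unfolding emb using cyl cnt disj by (simp add: emeasure_UN_countable A B)
qed

text \<open>Relative to the stationary law, both sides integrate \<open>g\<close> over paths with a
  visit to \<open>i\<close> and with the tilt factor of \<open>\<nu>\<close> at offset
  \<open>l\<close> from that visit. The left side has its origin at the tilted site, the right side
  at the visit to \<open>i\<close>, hence the shift inside \<open>g\<close>. Comparing cylinders
  suffices.\<close>

lemma two_sided_markov_chain_shift:
  fixes p :: "'s::countable \<Rightarrow> 's \<Rightarrow> real"
  assumes P: "sets P = sets path_space" "two_sided_markov_chain p m (return_pmf i) P (\<lambda>n \<omega>. \<omega> n)"
    and chain: "two_sided_markov_chain p m \<nu> M X" and m: "\<And>j. 0 < m j"
    and g: "g \<in> borel_measurable path_space"
  shows "(\<integral>\<^sup>+ z. indicator {i} (X (- l) z) * g (\<lambda>n. X n z) \<partial>M) =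
    (\<integral>\<^sup>+ \<omega>. ennreal (site_weight m \<nu> i (\<omega> l)) * g (\<lambda>n. \<omega> (n + l)) \<partial>P)"
proof -
  interpret M: prob_space M using chain by (rule two_sided_markov_chain_prob_space)
  interpret P: prob_space P using P(2) by (rule two_sided_markov_chain_prob_space)
  have X[measurable]: "X n \<in> M \<rightarrow>\<^sub>M count_space UNIV" for n
    using chain by (rule two_sided_markov_chain_measurable)
  have Xp[measurable]: "(\<lambda>z n. X n z) \<in> M \<rightarrow>\<^sub>M path_space"
    using X by (rule measurable_into_path_space)
  note [measurable_cong] = P(1)
  have spP: "space P = UNIV" using sets_eq_imp_space_eq[OF P(1)] by simp
  define A where "A = distr (density M (\<lambda>z. indicator {i} (X (- l) z))) path_space (\<lambda>z n. X n z)"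
  define B where "B = distr (density P (\<lambda>\<omega>. ennreal (site_weight m \<nu> i (\<omega> l)))) path_space (\<lambda>\<omega> n. \<omega> (n + l))"
  have "A = B"
  proof (rule path_space_measure_eqI)
    show "sets A = sets path_space" "sets B = sets path_space" by (simp_all add: A_def B_def)
    show "finite_measure A"
    proof
      have "emeasure A (space A) = (\<integral>\<^sup>+ z. indicator {i} (X (- l) z) \<partial>M)"
        unfolding A_def by (subst emeasure_distr) (simp_all add: emeasure_density)
      also have "\<dots> \<le> (\<integral>\<^sup>+ z. 1 \<partial>M)" by (intro nn_integral_mono) (auto simp: indicator_def)
      also have "\<dots> = 1" by (simp add: M.emeasure_space_1)
      finally show "emeasure A (space A) \<noteq> \<infinity>" by (auto simp: top_unique)
    qed
    \<comment> \<open>A window of radius at least \<open>\<bar>l\<bar>\<close> determines the state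
      at \<open>- l\<close>.\<close>
    fix n x assume n: "nat \<bar>l\<bar> \<le> n"
    let ?C = "{\<omega>::int \<Rightarrow> 's. \<forall>k\<in>{- int n..int n}. \<omega> k = x k}"
    have C[measurable]: "?C \<in> sets path_space"
    proof -
      have "Measurable.pred path_space (\<lambda>\<omega>. \<forall>k\<in>{- int n..int n}. \<omega> k = x k)" by measurable
      then show ?thesis by (simp add: pred_def)
    qed
    define w where "w = (\<Prod>k\<in>{- int n..<int n}. p (x k) (x (k + 1)))"
    have "emeasure A ?C = (\<integral>\<^sup>+ z. indicator {i} (X (- l) z) * indicator ?C (\<lambda>n. X n z) \<partial>M)"
      unfolding A_def
      by (subst nn_integral_indicator[symmetric], simp, subst nn_integral_distr, simp, simp)
         (simp add: nn_integral_density)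
    also have "\<dots> = (\<integral>\<^sup>+ z. indicator {i} (x (- l)) * indicator {z \<in> space M. \<forall>k\<in>{- int n..int n}. X k z = x k} z \<partial>M)"
    proof (rule nn_integral_cong)
      fix z assume z: "z \<in> space M"
      have "- l \<in> {- int n..int n}" using n by auto
      then have "X (- l) z = x (- l)" if "\<forall>k\<in>{- int n..int n}. X k z = x k" using that by blast
      then show "indicator {i} (X (- l) z) * indicator ?C (\<lambda>n. X n z) = (indicator {i} (x (- l)) :: ennreal) *
          indicator {z \<in> space M. \<forall>k\<in>{- int n..int n}. X k z = x k} z"
        using z by (cases "\<forall>k\<in>{- int n..int n}. X k z = x k") (auto simp: indicator_def)
    qed
    also have "\<dots> = indicator {i} (x (- l)) * ennreal (pmf \<nu> (x 0) / m (x 0) * m (x (- int n)) * w)"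
      using two_sided_markov_chain_cylinder[OF chain m, of n n x]
      by (subst nn_integral_cmult_indicator) (simp_all add: M.emeasure_eq_measure w_def)
    finally have eA: "emeasure A ?C = indicator {i} (x (- l)) * ennreal (pmf \<nu> (x 0) / m (x 0) * m (x (- int n)) * w)" .
    \<comment> \<open>Seen from the visit to \<open>i\<close>, the symmetric window becomes
      \<open>{l - int n..l + int n}\<close>; this is why cylinders over asymmetric windows are
      needed.\<close>
    define a b where "a = nat (int n - l)" and "b = nat (int n + l)"
    have ab: "- int a = l - int n" "int b = int n + l" using n by (auto simp: a_def b_def)
    let ?D = "{\<omega> \<in> space P. \<forall>k\<in>{- int a..int b}. \<omega> k = x (k - l)}"
    have D: "(\<lambda>n. \<omega> (n + l)) \<in> ?C \<longleftrightarrow> \<omega> \<in> ?D" for \<omega>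
    proof
      assume L: "(\<lambda>n. \<omega> (n + l)) \<in> ?C"
      have "\<omega> k = x (k - l)" if "k \<in> {- int a..int b}" for k
      proof -
        have "k - l \<in> {- int n..int n}" using that unfolding ab by auto
        then have "\<omega> (k - l + l) = x (k - l)" using L by blast
        then show ?thesis by simp
      qed
      then show "\<omega> \<in> ?D" by (simp add: spP)
    next
      assume R: "\<omega> \<in> ?D"
      have "\<omega> (k + l) = x k" if "k \<in> {- int n..int n}" for k
      proof -
        have "k + l \<in> {- int a..int b}" using that unfolding ab by auto
        then have "\<omega> (k + l) = x (k + l - l)" using R by blast
        then show ?thesis by simp
      qed
      then show "(\<lambda>n. \<omega> (n + l)) \<in> ?C" by simp
    qed
    have "(\<Prod>k\<in>{- int a..<int b}. p (x (k - l)) (x (k + 1 - l))) = w"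
      unfolding w_def ab
      by (rule prod.reindex_bij_witness[of _ "\<lambda>k. k + l" "\<lambda>k. k - l"]) (auto simp: algebra_simps)
    then have PD: "measure P ?D = indicator {i} (x (- l)) / m (x (- l)) * m (x (- int n)) * w"
      using two_sided_markov_chain_cylinder[OF P(2) m, of a b "\<lambda>k. x (k - l)"] ab
      by (simp add: indicator_def)
    have "emeasure B ?C = (\<integral>\<^sup>+ \<omega>. ennreal (site_weight m \<nu> i (\<omega> l)) * indicator ?C (\<lambda>n. \<omega> (n + l)) \<partial>P)"
      unfolding B_def
      by (subst nn_integral_indicator[symmetric], simp, subst nn_integral_distr, simp, simp)
         (simp add: nn_integral_density)
    also have "\<dots> = (\<integral>\<^sup>+ \<omega>. ennreal (site_weight m \<nu> i (x 0)) * indicator ?D \<omega> \<partial>P)"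
    proof (rule nn_integral_cong)
      fix \<omega>
      have "l \<in> {- int a..int b}" using n unfolding ab by auto
      then have "\<omega> l = x (l - l)" if "\<omega> \<in> ?D" using that by blast
      then show "ennreal (site_weight m \<nu> i (\<omega> l)) * indicator ?C (\<lambda>n. \<omega> (n + l)) =
          ennreal (site_weight m \<nu> i (x 0)) * indicator ?D \<omega>"
        unfolding indicator_def using D[of \<omega>] by auto
    qed
    also have "\<dots> = ennreal (site_weight m \<nu> i (x 0)) * ennreal (indicator {i} (x (- l)) / m (x (- l)) * m (x (- int n)) * w)"
      by (subst nn_integral_cmult_indicator) (simp_all add: P.emeasure_eq_measure PD)
    also have "\<dots> = indicator {i} (x (- l)) * ennreal (pmf \<nu> (x 0) / m (x 0) * m (x (- int n)) * w)"
    proof (cases "x (- l) = i")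
      case True
      then show ?thesis using m[of i] m[of "x 0"]
        by (simp add: site_weight_def ennreal_mult'[symmetric] mult.assoc)
    qed simp
    finally show "emeasure A ?C = emeasure B ?C" using eA by simp
  qed
  have "(\<integral>\<^sup>+ z. indicator {i} (X (- l) z) * g (\<lambda>n. X n z) \<partial>M) = integral\<^sup>N A g"
    unfolding A_def using g by (simp add: nn_integral_distr nn_integral_density)
  also have "\<dots> = integral\<^sup>N B g" using \<open>A = B\<close> by simp
  also have "\<dots> = (\<integral>\<^sup>+ \<omega>. ennreal (site_weight m \<nu> i (\<omega> l)) * g (\<lambda>n. \<omega> (n + l)) \<partial>P)"
    unfolding B_def using g by (simp add: nn_integral_distr nn_integral_density)
  finally show ?thesis .
qed

text \<open>This is the shift identity for \<open>\<nu> = return_pmf i\<close>, with the path itself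
  as the chain. It allows the origin to be moved from one visit to \<open>i\<close> to
  another.\<close>

lemma point_stationary:
  fixes p :: "'s::countable \<Rightarrow> 's \<Rightarrow> real"
  assumes P: "sets P = sets path_space" "two_sided_markov_chain p m (return_pmf i) P (\<lambda>n \<omega>. \<omega> n)"
    and m: "\<And>j. 0 < m j" and g: "g \<in> borel_measurable path_space"
  shows "(\<integral>\<^sup>+ \<omega>. indicator {i} (\<omega> l) * g (\<lambda>n. \<omega> (n + l)) \<partial>P) =
    (\<integral>\<^sup>+ \<omega>. indicator {i} (\<omega> (- l)) * g \<omega> \<partial>P)"
proof -
  have "ennreal (site_weight m (return_pmf i) i j) = indicator {i} j" for j
    using m[of j] by (auto simp: site_weight_def indicator_def)
  then show ?thesis
    using two_sided_markov_chain_shift[OF P P(2) m g, of l] by simp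
qed

section \<open>Matching inside a finite window\<close>

text \<open>Cut \<open>{x..r}\<close> before each later element of \<open>U\<close>. Every piece
  starts at an element of \<open>U\<close> and so has sum at least one, and there are as many pieces
  as elements of \<open>U\<close> from \<open>x\<close> on.\<close>

lemma card_positive_sums_le:
  fixes f :: "nat \<Rightarrow> real" and r :: nat
  defines "U \<equiv> {x. x \<le> r \<and> (\<forall>y\<in>{x..r}. 1 \<le> sum f {x..y})}"
  assumes "x \<in> U"
  shows "real (card (U \<inter> {x..r})) \<le> sum f {x..r}"
  using assms(2)
proof (induction "r - x" arbitrary: x rule: less_induct)
  case less
  have xr: "x \<le> r" and f1: "\<And>y. y \<in> {x..r} \<Longrightarrow> 1 \<le> sum f {x..y}"
    using less.prems by (auto simp: U_def)
  let ?V = "U \<inter> {x<..r}"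
  have fin: "finite ?V" by simp
  show ?case
  proof (cases "?V = {}")
    case True
    then have "U \<inter> {x..r} = {x}" using less.prems xr
      by (auto simp: greaterThanAtMost_def dest: le_neq_implies_less)
    then show ?thesis using f1[of r] xr by simp
  next
    case False
    \<comment> \<open>The next element of \<open>U\<close> ends the first piece; the induction
      hypothesis covers the rest.\<close>
    define x' where "x' = Min ?V"
    have x': "x' \<in> U" "x < x'" "x' \<le> r" using Min_in[OF fin False] by (auto simp: x'_def)
    have eq: "U \<inter> {x..r} = insert x (U \<inter> {x'..r})"
    proof (intro set_eqI iffI)
      fix v assume v: "v \<in> U \<inter> {x..r}"
      show "v \<in> insert x (U \<inter> {x'..r})"
      proof (cases "v = x")
        case False
        then have "v \<in> ?V" using v by auto
        then have "x' \<le> v" unfolding x'_def by (rule Min_le[OF fin])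
        then show ?thesis using v by auto
      qed simp
    qed (use x' less.prems xr in auto)
    have "real (card (U \<inter> {x..r})) = 1 + real (card (U \<inter> {x'..r}))"
      unfolding eq using x' by (subst card_insert_disjoint) auto
    also have "\<dots> \<le> sum f {x..x' - 1} + sum f {x'..r}"
    proof (intro add_mono)
      show "1 \<le> sum f {x..x' - 1}" using x' by (intro f1) auto
      show "real (card (U \<inter> {x'..r})) \<le> sum f {x'..r}"
        using x' by (intro less.hyps) auto
    qed
    also have "\<dots> = sum f ({x..x' - 1} \<union> {x'..r})"
      using x' by (intro sum.union_disjoint[symmetric]) auto
    also have "{x..x' - 1} \<union> {x'..r} = {x..r}" using x' by auto
    finally show ?thesis .
  qed
qed

text \<open>In the application \<open>u\<close> marks sources, \<open>b\<close> is the absorbing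
  capacity and \<open>K\<close> a transport plan; the set then consists of the sources that
  last-in-first-out matching leaves unmatched up to \<open>r\<close>. If \<open>x\<close> is the
  first of them, their number is at most supply minus capacity of \<open>{x..r}\<close>. The plan
  delivers no more than that capacity from sources in \<open>{x..r}\<close> to sites in
  \<open>{x..r}\<close>, so the rest of their mass must leave past \<open>r\<close>.\<close>

lemma unmatched_le_escaping:
  fixes u b :: "nat \<Rightarrow> real" and K :: "nat \<Rightarrow> nat \<Rightarrow> real"
  assumes u: "\<And>x. 0 \<le> u x" and K: "\<And>x z. (\<Sum>l\<le>z. K x l) \<le> 1"
    and balance: "\<And>x1 y. (\<Sum>x\<in>{x1..y}. u x * K x (y - x)) \<le> b y"
  shows "real (card {x. x \<le> r \<and> (\<forall>y\<in>{x..r}. 1 \<le> (\<Sum>k\<in>{x..y}. u k - b k))})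
    \<le> (\<Sum>x\<le>r. u x * (1 - (\<Sum>l\<le>r - x. K x l)))"
    (is "real (card ?U) \<le> ?R")
proof (cases "?U = {}")
  case True
  have "0 \<le> ?R" by (intro sum_nonneg mult_nonneg_nonneg u) (use K in simp)
  then show ?thesis unfolding True by simp
next
  case False
  have fin: "finite ?U" by (rule finite_subset[of _ "{..r}"]) auto
  define x where "x = Min ?U"
  have x: "x \<in> ?U" using Min_in[OF fin False] by (simp only: x_def)
  have "?U \<inter> {x..r} = ?U" using Min_le[OF fin] by (auto simp: x_def)
  then have "real (card ?U) \<le> (\<Sum>k\<in>{x..r}. u k - b k)"
    using card_positive_sums_le[of x r "\<lambda>k. u k - b k"] x by simp
  also have "\<dots> \<le> (\<Sum>k\<in>{x..r}. u k) - (\<Sum>y\<in>{x..r}. \<Sum>k\<in>{x..y}. u k * K k (y - k))"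
    unfolding sum_subtractf using balance by (intro diff_left_mono sum_mono)
  \<comment> \<open>Regroup the delivered mass by source instead of by destination.\<close>
  also have "(\<Sum>y\<in>{x..r}. \<Sum>k\<in>{x..y}. u k * K k (y - k)) =
      (\<Sum>k\<in>{x..r}. \<Sum>y\<in>{k..r}. u k * K k (y - k))"
    unfolding sum.Sigma[of "{x..r}" "\<lambda>y. {x..y}", simplified] sum.Sigma[of "{x..r}" "\<lambda>k. {k..r}", simplified]
    by (rule sum.reindex_bij_witness[of _ "\<lambda>(a,b). (b,a)" "\<lambda>(a,b). (b,a)"]) auto
  also have "\<dots> = (\<Sum>k\<in>{x..r}. u k * (\<Sum>l\<le>r - k. K k l))"
  proof (rule sum.cong)
    fix k assume "k \<in> {x..r}"
    then have "(\<Sum>y\<in>{k..r}. K k (y - k)) = (\<Sum>l\<le>r - k. K k l)"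
      by (intro sum.reindex_bij_witness[of _ "\<lambda>l. l + k" "\<lambda>y. y - k"]) auto
    then show "(\<Sum>y\<in>{k..r}. u k * K k (y - k)) = u k * (\<Sum>l\<le>r - k. K k l)"
      by (simp add: sum_distrib_left[symmetric])
  qed simp
  also have "(\<Sum>k\<in>{x..r}. u k) - \<dots> = (\<Sum>k\<in>{x..r}. u k * (1 - (\<Sum>l\<le>r - k. K k l)))"
    by (simp add: sum_subtractf[symmetric] algebra_simps)
  \<comment> \<open>Sources before \<open>x\<close> can only enlarge the escaping mass.\<close>
  also have "\<dots> \<le> ?R"
  proof (rule sum_mono2)
    show "0 \<le> u k * (1 - (\<Sum>l\<le>r - k. K k l))" for k
      using u[of k] K[of k "r - k"] by simp
  qed auto
  finally show ?thesis by simp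
qed

section \<open>Concave functions and tail probabilities\<close>

text \<open>Summation by parts in inductive form: the claim is strengthened to the lower bound
  \<open>d n * (\<Sum>z<n. e z)\<close> for the weighted sum. The sign is known only for the partial
  sums of \<open>e\<close>, not for its terms.\<close>

lemma abel_sum_nonneg:
  fixes d e :: "nat \<Rightarrow> real"
  assumes d: "decseq d" "\<And>n. 0 \<le> d n" and E: "\<And>k. 0 \<le> (\<Sum>z<k. e z)"
  shows "0 \<le> (\<Sum>z<n. d z * e z)"
proof -
  have "d n * (\<Sum>z<n. e z) \<le> (\<Sum>z<n. d z * e z)"
  proof (induction n)
    case (Suc n)
    have "d (Suc n) * (\<Sum>z<Suc n. e z) \<le> d n * (\<Sum>z<Suc n. e z)"
      using d(1) E[of "Suc n"] by (intro mult_right_mono) (auto simp: decseq_Suc_iff)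
    also have "\<dots> \<le> (\<Sum>z<Suc n. d z * e z)" using Suc by (simp add: algebra_simps)
    finally show ?case .
  qed simp
  then show ?thesis using d(2)[of n] E[of n] by (meson mult_nonneg_nonneg order_trans)
qed

lemma concave_nat_decseq:
  assumes "concave_nat \<psi>"
  shows "decseq (\<lambda>n. \<psi> (Suc n) - \<psi> n)"
proof (subst decseq_Suc_iff, intro allI)
  fix n
  have "0 \<le> (1/2::real) \<and> 1/2 \<le> (1::real) \<and> real (Suc n) = (1 - 1/2) * real n + 1/2 * real (Suc (Suc n))"
    by (simp add: field_simps)
  then have "(1 - 1/2) * \<psi> n + 1/2 * \<psi> (Suc (Suc n)) \<le> \<psi> (Suc n)"
    using assms unfolding concave_nat_def by blast
  then show "\<psi> (Suc (Suc n)) - \<psi> (Suc n) \<le> \<psi> (Suc n) - \<psi> n" by simp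
qed

text \<open>Increments are nonincreasing, so one strict decrease by \<open>c\<close> would recur at
  every later step and force \<open>\<psi>\<close> below zero.\<close>

lemma concave_nat_nonneg_mono:
  assumes "concave_nat \<psi>" and nonneg: "\<And>n. 0 \<le> \<psi> n"
  shows "\<psi> n \<le> \<psi> (Suc n)"
proof (rule ccontr)
  assume not_le: "\<not> \<psi> n \<le> \<psi> (Suc n)"
  define c where "c = \<psi> n - \<psi> (Suc n)"
  have c: "c > 0" using not_le by (simp add: c_def)
  have step: "\<psi> (Suc (n + k)) - \<psi> (n + k) \<le> - c" for k
    using decseqD[OF concave_nat_decseq[OF assms(1)], of n "n + k"] by (simp add: c_def)
  have "\<psi> (n + k) \<le> \<psi> n - real k * c" for k
  proof (induction k)
    case (Suc k)
    then show ?case using step[of k] by (simp add: algebra_simps)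
  qed simp
  note bound = this
  obtain k :: nat where "\<psi> n < real k * c"
    using reals_Archimedean3[OF c] by blast
  then show False using nonneg[of "n + k"] bound[of k] by linarith
qed

text \<open>A layer-cake formula: write \<open>\<psi> n\<close> as \<open>\<psi> 0\<close> plus its
  increments below \<open>n\<close>. Monotonicity makes the increments nonnegative, so sum and
  integral may be exchanged even when the result is infinite.\<close>

lemma nn_integral_tails:
  fixes \<tau> :: "'a \<Rightarrow> nat"
  assumes M: "prob_space M" and \<tau>[measurable]: "\<tau> \<in> M \<rightarrow>\<^sub>M count_space UNIV"
    and mono: "\<And>n. \<psi> n \<le> \<psi> (Suc n)" and nonneg: "\<And>n. 0 \<le> \<psi> n"
  shows "(\<integral>\<^sup>+ x. ennreal (\<psi> (\<tau> x)) \<partial>M) =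
    ennreal (\<psi> 0) + (\<Sum>z. ennreal ((\<psi> (Suc z) - \<psi> z) * measure M {x \<in> space M. z < \<tau> x}))"
proof -
  interpret prob_space M by fact
  define d where "d n = \<psi> (Suc n) - \<psi> n" for n
  have d: "0 \<le> d n" for n using mono by (simp add: d_def)
  have telescope: "\<psi> n = \<psi> 0 + (\<Sum>z<n. d z)" for n
    by (simp add: d_def sum_lessThan_telescope)
  have layer: "ennreal (\<psi> n) = ennreal (\<psi> 0) + (\<Sum>z. ennreal (d z) * indicator {z. z < n} z)" for n
  proof -
    have "(\<Sum>z. ennreal (d z) * indicator {z. z < n} z) = (\<Sum>z<n. ennreal (d z) * indicator {z. z < n} z)"
      by (rule suminf_finite) auto
    also have "\<dots> = ennreal (\<Sum>z<n. d z)" using d by (simp add: sum_ennreal)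
    finally show ?thesis using nonneg[of 0] d telescope[of n]
      by (simp add: ennreal_plus[symmetric] sum_nonneg del: ennreal_plus)
  qed
  have [measurable]: "{x \<in> space M. z < \<tau> x} \<in> events" for z by measurable
  have "(\<integral>\<^sup>+ x. ennreal (\<psi> (\<tau> x)) \<partial>M) =
      (\<integral>\<^sup>+ x. ennreal (\<psi> 0) + (\<Sum>z. ennreal (d z) * indicator {x \<in> space M. z < \<tau> x} x) \<partial>M)"
    by (rule nn_integral_cong) (subst layer, auto simp: indicator_def)
  also have "\<dots> = ennreal (\<psi> 0) + (\<Sum>z. \<integral>\<^sup>+ x. ennreal (d z) * indicator {x \<in> space M. z < \<tau> x} x \<partial>M)"
    by (subst nn_integral_add) (simp_all add: nn_integral_suminf emeasure_space_1)
  also have "(\<lambda>z. \<integral>\<^sup>+ x. ennreal (d z) * indicator {x \<in> space M. z < \<tau> x} x \<partial>M) =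
      (\<lambda>z. ennreal (d z * measure M {x \<in> space M. z < \<tau> x}))"
    using d by (intro ext, subst nn_integral_cmult_indicator)
      (simp_all add: emeasure_eq_measure ennreal_mult)
  finally show ?thesis by (simp add: d_def)
qed

text \<open>A nonnegative concave \<open>\<psi>\<close> is a mixture of the constant, the identity and the functions
  \<open>min n k\<close>; comparing partial sums of tails amounts to comparing the latter.\<close>

lemma nn_integral_concave_mono:
  fixes \<tau> :: "'a \<Rightarrow> nat" and \<sigma> :: "'b \<Rightarrow> nat"
  assumes M: "prob_space M" and N: "prob_space N"
    and \<tau>[measurable]: "\<tau> \<in> M \<rightarrow>\<^sub>M count_space UNIV" and \<sigma>[measurable]: "\<sigma> \<in> N \<rightarrow>\<^sub>M count_space UNIV"
    and tails: "\<And>k. (\<Sum>z<k. measure M {x \<in> space M. z < \<tau> x}) \<le> (\<Sum>z<k. measure N {x \<in> space N. z < \<sigma> x})"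
    and \<psi>: "concave_nat \<psi>" "\<And>n. 0 \<le> \<psi> n"
  shows "(\<integral>\<^sup>+ x. ennreal (\<psi> (\<tau> x)) \<partial>M) \<le> (\<integral>\<^sup>+ x. ennreal (\<psi> (\<sigma> x)) \<partial>N)"
proof -
  define d where "d n = \<psi> (Suc n) - \<psi> n" for n
  have d: "decseq d" "\<And>n. 0 \<le> d n"
    using concave_nat_decseq[OF \<psi>(1)] concave_nat_nonneg_mono[OF \<psi>] by (auto simp: d_def[abs_def])
  have "(\<Sum>z. ennreal (d z * measure M {x \<in> space M. z < \<tau> x})) \<le>
      (\<Sum>z. ennreal (d z * measure N {x \<in> space N. z < \<sigma> x}))"
  \<comment> \<open>The tails are ordered only in sum, not termwise, so the comparison goes through
    partial sums; the series themselves may be infinite.\<close>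
  proof (rule suminf_le_const[OF summableI])
    fix n
    have "0 \<le> (\<Sum>z<n. d z * (measure N {x \<in> space N. z < \<sigma> x} - measure M {x \<in> space M. z < \<tau> x}))"
      by (rule abel_sum_nonneg[OF d]) (use tails in \<open>simp add: sum_subtractf\<close>)
    then have "(\<Sum>z<n. d z * measure M {x \<in> space M. z < \<tau> x}) \<le> (\<Sum>z<n. d z * measure N {x \<in> space N. z < \<sigma> x})"
      by (simp add: sum_subtractf algebra_simps)
    then have "(\<Sum>z<n. ennreal (d z * measure M {x \<in> space M. z < \<tau> x})) \<le>
        (\<Sum>z<n. ennreal (d z * measure N {x \<in> space N. z < \<sigma> x}))"
      using d(2) by (simp add: sum_ennreal ennreal_leI)
    also have "\<dots> \<le> (\<Sum>z. ennreal (d z * measure N {x \<in> space N. z < \<sigma> x}))"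
      by (rule sum_le_suminf) auto
    finally show "(\<Sum>z<n. ennreal (d z * measure M {x \<in> space M. z < \<tau> x})) \<le>
      (\<Sum>z. ennreal (d z * measure N {x \<in> space N. z < \<sigma> x}))" .
  qed
  then show ?thesis
    unfolding nn_integral_tails[where \<psi>=\<psi>, OF M \<tau> concave_nat_nonneg_mono[OF \<psi>] \<psi>(2)]
      nn_integral_tails[where \<psi>=\<psi>, OF N \<sigma> concave_nat_nonneg_mono[OF \<psi>] \<psi>(2)] d_def
    by (rule add_left_mono)
qed

section \<open>Randomized times as transport plans\<close>

text \<open>Test the hypothesis on the set where the inequality fails. Since the integral of
  \<open>h\<close> is finite it can be subtracted, and a truncated difference with integral zero
  vanishes almost everywhere.\<close>

lemma AE_le_if_nn_integral_le:
  fixes f h :: "'a \<Rightarrow> ennreal"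
  assumes [measurable]: "f \<in> borel_measurable M" "h \<in> borel_measurable M"
    and le: "\<And>A. A \<in> sets M \<Longrightarrow> (\<integral>\<^sup>+ x. f x * indicator A x \<partial>M) \<le> (\<integral>\<^sup>+ x. h x * indicator A x \<partial>M)"
    and fin: "(\<integral>\<^sup>+ x. h x \<partial>M) < \<infinity>"
  shows "AE x in M. f x \<le> h x"
proof -
  define A where "A = {x \<in> space M. h x < f x}"
  have A[measurable]: "A \<in> sets M" unfolding A_def by measurable
  have "(\<integral>\<^sup>+ x. h x * indicator A x \<partial>M) \<le> (\<integral>\<^sup>+ x. h x \<partial>M)"
    by (intro nn_integral_mono) (auto simp: indicator_def)
  then have fin': "(\<integral>\<^sup>+ x. h x * indicator A x \<partial>M) \<noteq> \<infinity>" using fin by auto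
  have "(\<integral>\<^sup>+ x. f x * indicator A x - h x * indicator A x \<partial>M) =
      (\<integral>\<^sup>+ x. f x * indicator A x \<partial>M) - (\<integral>\<^sup>+ x. h x * indicator A x \<partial>M)"
    by (rule nn_integral_diff) (use fin' in \<open>auto simp: A_def indicator_def\<close>)
  also have "\<dots> = 0" using le[OF A] fin' by (simp add: diff_eq_0_iff_ennreal less_top)
  finally have ae: "AE x in M. f x * indicator A x - h x * indicator A x = 0"
    by (subst (asm) nn_integral_0_iff_AE) auto
  have imp: "f x \<le> h x" if "x \<in> space M" "f x * indicator A x - h x * indicator A x = 0" for x
  proof (rule ccontr)
    assume "\<not> f x \<le> h x"
    then have "h x < f x" by simp
    then have "f x - h x = 0" using that by (simp add: A_def)
    then show False using \<open>h x < f x\<close> by (auto simp: diff_eq_0_iff_ennreal)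
  qed
  show ?thesis by (rule AE_mp[OF ae]) (rule AE_I2, use imp in blast)
qed

lemma space_eq_UNIV_path: "sets P = sets path_space \<Longrightarrow> space P = UNIV"
  using sets_eq_imp_space_eq[of P path_space] by simp

lemma
  assumes P: "sets P = sets path_space" and Q: "Q \<in> path_space \<rightarrow>\<^sub>M prob_algebra R"
  shows sets_extended_law: "sets (extended_law P R Q) = sets (path_space \<Otimes>\<^sub>M R)"
    and nn_integral_extended_law: "f \<in> borel_measurable (path_space \<Otimes>\<^sub>M R) \<Longrightarrow>
      (\<integral>\<^sup>+ z. f z \<partial>extended_law P R Q) = (\<integral>\<^sup>+ \<omega>. \<integral>\<^sup>+ r. f (\<omega>, r) \<partial>Q \<omega> \<partial>P)"
proof -
  have Qs[measurable]: "Q \<in> path_space \<rightarrow>\<^sub>M subprob_algebra R"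
    using Q by (rule measurable_prob_algebraD)
  note [measurable_cong] = P
  have K: "(\<lambda>\<omega>. distr (Q \<omega>) (path_space \<Otimes>\<^sub>M R) (Pair \<omega>)) \<in> P \<rightarrow>\<^sub>M subprob_algebra (path_space \<Otimes>\<^sub>M R)"
    by (rule measurable_distr2[where M=R]) measurable
  show "sets (extended_law P R Q) = sets (path_space \<Otimes>\<^sub>M R)"
    unfolding extended_law_def by (rule sets_bind) (use P space_eq_UNIV_path in auto)
  assume f: "f \<in> borel_measurable (path_space \<Otimes>\<^sub>M R)"
  have sQ: "sets (Q \<omega>) = sets R" for \<omega>
    by (rule sets_kernel[OF Qs]) simp
  have "(\<integral>\<^sup>+ z. f z \<partial>extended_law P R Q) =
      (\<integral>\<^sup>+ \<omega>. \<integral>\<^sup>+ z. f z \<partial>distr (Q \<omega>) (path_space \<Otimes>\<^sub>M R) (Pair \<omega>) \<partial>P)"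
    unfolding extended_law_def by (rule nn_integral_bind[OF f K])
  also have "\<dots> = (\<integral>\<^sup>+ \<omega>. \<integral>\<^sup>+ r. f (\<omega>, r) \<partial>Q \<omega> \<partial>P)"
  proof (rule nn_integral_cong)
    fix \<omega>
    have "Pair \<omega> \<in> Q \<omega> \<rightarrow>\<^sub>M path_space \<Otimes>\<^sub>M R"
      by (subst measurable_cong_sets[OF sQ refl]) (auto intro: measurable_Pair1')
    then show "(\<integral>\<^sup>+ z. f z \<partial>distr (Q \<omega>) (path_space \<Otimes>\<^sub>M R) (Pair \<omega>)) = (\<integral>\<^sup>+ r. f (\<omega>, r) \<partial>Q \<omega>)"
      by (rule nn_integral_distr) (use f in simp)
  qed
  finally show "(\<integral>\<^sup>+ z. f z \<partial>extended_law P R Q) = (\<integral>\<^sup>+ \<omega>. \<integral>\<^sup>+ r. f (\<omega>, r) \<partial>Q \<omega> \<partial>P)" .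
qed

text \<open>The share of its mass that a source at the origin sends \<open>l\<close> steps ahead. As
  \<open>T\<close> is nonnegative only almost surely, the shares of an individual path may add up to
  less than one.\<close>

definition jump_prob :: "((int \<Rightarrow> 's::countable) \<Rightarrow> 'r measure) \<Rightarrow> ((int \<Rightarrow> 's) \<times> 'r \<Rightarrow> int) \<Rightarrow>
    (int \<Rightarrow> 's) \<Rightarrow> nat \<Rightarrow> real" where
  "jump_prob Q T \<omega> l = measure (Q \<omega>) {r \<in> space (Q \<omega>). T (\<omega>, r) = int l}"

lemma
  fixes Q :: "(int \<Rightarrow> 's::countable) \<Rightarrow> 'r measure"
  assumes Q: "Q \<in> path_space \<rightarrow>\<^sub>M prob_algebra R"
    and T: "T \<in> path_space \<Otimes>\<^sub>M R \<rightarrow>\<^sub>M count_space UNIV"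
  shows jump_prob_eq: "ennreal (jump_prob Q T \<omega> l) = (\<integral>\<^sup>+ r. indicator {int l} (T (\<omega>, r)) \<partial>Q \<omega>)"
    and measurable_jump_prob: "(\<lambda>\<omega>. jump_prob Q T \<omega> l) \<in> borel_measurable path_space"
    and sum_jump_prob_le: "(\<Sum>l\<le>z. jump_prob Q T \<omega> l) \<le> 1"
proof -
  have Qs[measurable]: "Q \<in> path_space \<rightarrow>\<^sub>M subprob_algebra R"
    using Q by (rule measurable_prob_algebraD)
  note T[measurable]
  have sQ[measurable_cong]: "sets (Q \<omega>) = sets R" for \<omega>
    by (rule sets_kernel[OF Qs]) simp
  have pQ: "prob_space (Q \<omega>)" for \<omega>
    using measurable_space[OF Q, of \<omega>] by (simp add: space_prob_algebra)
  have T1: "(\<lambda>r. T (\<omega>, r)) \<in> Q \<omega> \<rightarrow>\<^sub>M count_space UNIV" for \<omega>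
    by (subst measurable_cong_sets[OF sQ refl], rule measurable_compose[OF measurable_Pair1' T]) simp
  have S: "{r \<in> space (Q \<omega>). T (\<omega>, r) = int l} \<in> sets (Q \<omega>)" for \<omega> l
    using measurable_sets[OF T1, of "{int l}" \<omega>] by (simp add: vimage_def Int_def conj_commute)
  show eq: "ennreal (jump_prob Q T \<omega> l) = (\<integral>\<^sup>+ r. indicator {int l} (T (\<omega>, r)) \<partial>Q \<omega>)" for \<omega> l
  proof -
    interpret prob_space "Q \<omega>" by (rule pQ)
    have "(\<integral>\<^sup>+ r. indicator {int l} (T (\<omega>, r)) \<partial>Q \<omega>) = (\<integral>\<^sup>+ r. indicator {r \<in> space (Q \<omega>). T (\<omega>, r) = int l} r \<partial>Q \<omega>)"
      by (rule nn_integral_cong) (auto simp: indicator_def)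
    then show ?thesis using S by (simp add: jump_prob_def emeasure_eq_measure)
  qed
  have "(\<lambda>(\<omega>, r). indicator {int l} (T (\<omega>, r)) :: ennreal) = (\<lambda>z. indicator {int l} (T z))"
    by auto
  moreover have "\<dots> \<in> borel_measurable (path_space \<Otimes>\<^sub>M R)"
    by (rule measurable_compose[OF T]) simp
  ultimately have "(\<lambda>(\<omega>, r). indicator {int l} (T (\<omega>, r)) :: ennreal) \<in> borel_measurable (path_space \<Otimes>\<^sub>M R)"
    by simp
  \<comment> \<open>Both the set and the measure in \<open>jump_prob\<close> depend on the path, so
    measurability is obtained from the kernel integral.\<close>
  then have "(\<lambda>\<omega>. enn2real (\<integral>\<^sup>+ r. indicator {int l} (T (\<omega>, r)) \<partial>Q \<omega>)) \<in> borel_measurable path_space"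
    by (intro borel_measurable_enn2real nn_integral_measurable_subprob_algebra2[OF _ Qs])
  then show "(\<lambda>\<omega>. jump_prob Q T \<omega> l) \<in> borel_measurable path_space"
    by (simp add: eq[symmetric] jump_prob_def)
  interpret prob_space "Q \<omega>" by (rule pQ)
  have "(\<Sum>l\<le>z. jump_prob Q T \<omega> l) = measure (Q \<omega>) (\<Union>l\<le>z. {r \<in> space (Q \<omega>). T (\<omega>, r) = int l})"
    unfolding jump_prob_def using S
    by (intro finite_measure_finite_Union[symmetric]) (auto simp: disjoint_family_on_def)
  then show "(\<Sum>l\<le>z. jump_prob Q T \<omega> l) \<le> 1" by simp
qed

lemma jump_prob_nonneg: "0 \<le> jump_prob Q T \<omega> l"
  by (simp add: jump_prob_def)

text \<open>A mass transport argument: the expected mass that the sources send to \<open>y\<close> is read off from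
  the law of the shifted path.\<close>

lemma jump_prob_balance:
  fixes p :: "'s::countable \<Rightarrow> 's \<Rightarrow> real"
  assumes P: "sets P = sets path_space" "two_sided_markov_chain p m (return_pmf i) P (\<lambda>n \<omega>. \<omega> n)"
    and m: "\<And>j. 0 < m j"
    and Q: "Q \<in> path_space \<rightarrow>\<^sub>M prob_algebra R" and T: "T \<in> path_space \<Otimes>\<^sub>M R \<rightarrow>\<^sub>M count_space UNIV"
    and sol: "two_sided_markov_chain p m \<nu> (extended_law P R Q) (\<lambda>n z. fst z (n + T z))"
  shows "AE \<omega> in P. (\<Sum>l\<le>N. indicator {i} (\<omega> (y - int l)) * jump_prob Q T (\<lambda>n. \<omega> (n + (y - int l))) l)
    \<le> site_weight m \<nu> i (\<omega> y)"
proof -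
  let ?E = "extended_law P R Q"
  let ?t = "jump_prob Q T"
  \<comment> \<open>\<open>h\<close> is the capacity of the site \<open>y\<close>, and
    \<open>f\<close> is the mass that it receives from sources at most \<open>N\<close> steps
    back.\<close>
  define h where "h \<omega> = ennreal (site_weight m \<nu> i (\<omega> y))" for \<omega> :: "int \<Rightarrow> 's"
  define f where "f \<omega> = (\<Sum>l\<le>N. indicator {i} (\<omega> (y - int l)) * ennreal (?t (\<lambda>n. \<omega> (n + (y - int l))) l))"
    for \<omega>
  have jm[measurable]: "(\<lambda>\<omega>. ?t \<omega> l) \<in> borel_measurable path_space" for l
    by (rule measurable_jump_prob[OF Q T])
  note [measurable_cong] = P(1)
  have jms[measurable]: "(\<lambda>\<omega>. ?t (\<lambda>n. \<omega> (n + k)) l) \<in> borel_measurable path_space" for l k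
    by (rule measurable_compose[OF measurable_path_shift jm])
  have hm[measurable]: "h \<in> borel_measurable path_space"
    unfolding h_def by measurable
  have fm[measurable]: "f \<in> borel_measurable path_space"
    unfolding f_def by measurable
  \<comment> \<open>Centred at \<open>T\<close>, the path is the chain with initial law
    \<open>\<nu>\<close>. The shift identity turns the capacity at \<open>y\<close> into the event
    that \<open>T - y\<close> is a visit to \<open>i\<close>, with \<open>g\<close> seeing the path
    from there.\<close>
  have key: "(\<integral>\<^sup>+ \<omega>. h \<omega> * g \<omega> \<partial>P) =
      (\<integral>\<^sup>+ z. indicator {i} (fst z (- y + T z)) * g (\<lambda>n. fst z (n - y + T z)) \<partial>?E)"
    if g[measurable]: "g \<in> borel_measurable path_space" for g :: "(int \<Rightarrow> 's) \<Rightarrow> ennreal"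
  proof -
    have gs: "(\<lambda>\<omega>. g (\<lambda>n. \<omega> (n + - y))) \<in> borel_measurable path_space"
      by (rule measurable_compose[OF measurable_path_shift g])
    show ?thesis
      using two_sided_markov_chain_shift[OF P sol m gs, of y] by (simp add: h_def)
  qed
  have le: "(\<integral>\<^sup>+ \<omega>. f \<omega> * g \<omega> \<partial>P) \<le> (\<integral>\<^sup>+ \<omega>. h \<omega> * g \<omega> \<partial>P)"
    if g[measurable]: "g \<in> borel_measurable path_space" for g :: "(int \<Rightarrow> 's) \<Rightarrow> ennreal"
  proof -
    \<comment> \<open>Once the origin is moved to the source at \<open>y - int l\<close>, the former
      origin sits at \<open>int l - y\<close>; it is a visit to \<open>i\<close>, and
      \<open>g\<close> still sees the path from it.\<close>
    define c where "c l \<omega> = indicator {i} (\<omega> (int l - y)) * g (\<lambda>n. \<omega> (n + (int l - y)))"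
      for l and \<omega> :: "int \<Rightarrow> 's"
    have gs[measurable]: "(\<lambda>\<omega>. g (\<lambda>n. \<omega> (n + k))) \<in> borel_measurable path_space" for k
      by (rule measurable_compose[OF measurable_path_shift g])
    have cm[measurable]: "c l \<in> borel_measurable path_space" for l
      unfolding c_def by measurable
    have ctm: "(\<lambda>z. indicator {int l} (T z) * c l (fst z)) \<in> borel_measurable (path_space \<Otimes>\<^sub>M R)" for l
      by (intro borel_measurable_times_ennreal measurable_compose[OF T] measurable_compose[OF measurable_fst cm]) simp
    have "(\<integral>\<^sup>+ \<omega>. f \<omega> * g \<omega> \<partial>P) =
        (\<Sum>l\<le>N. \<integral>\<^sup>+ \<omega>. indicator {i} (\<omega> (y - int l)) * (ennreal (?t (\<lambda>n. \<omega> (n + (y - int l))) l) * g \<omega>) \<partial>P)"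
      unfolding f_def by (subst nn_integral_sum[symmetric]) (simp_all add: sum_distrib_right mult.assoc)
    also have "\<dots> = (\<Sum>l\<le>N. \<integral>\<^sup>+ \<omega>. ennreal (?t \<omega> l) * c l \<omega> \<partial>P)"
    proof (rule sum.cong)
      fix l
      have G: "(\<lambda>\<omega>. ennreal (?t \<omega> l) * g (\<lambda>n. \<omega> (n + (int l - y)))) \<in> borel_measurable path_space"
        by measurable
      show "(\<integral>\<^sup>+ \<omega>. indicator {i} (\<omega> (y - int l)) * (ennreal (?t (\<lambda>n. \<omega> (n + (y - int l))) l) * g \<omega>) \<partial>P) =
          (\<integral>\<^sup>+ \<omega>. ennreal (?t \<omega> l) * c l \<omega> \<partial>P)"
        using point_stationary[OF P m G, of "y - int l"] by (simp add: c_def mult_ac)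
    qed simp
    also have "\<dots> = (\<Sum>l\<le>N. \<integral>\<^sup>+ z. indicator {int l} (T z) * c l (fst z) \<partial>?E)"
    proof (rule sum.cong)
      fix l
      have "(\<integral>\<^sup>+ z. indicator {int l} (T z) * c l (fst z) \<partial>?E) =
          (\<integral>\<^sup>+ \<omega>. \<integral>\<^sup>+ r. indicator {int l} (T (\<omega>, r)) * c l \<omega> \<partial>Q \<omega> \<partial>P)"
        by (subst nn_integral_extended_law[OF P(1) Q ctm]) simp
      also have "\<dots> = (\<integral>\<^sup>+ \<omega>. ennreal (?t \<omega> l) * c l \<omega> \<partial>P)"
      proof (rule nn_integral_cong)
        fix \<omega>
        have "(\<lambda>r. T (\<omega>, r)) \<in> R \<rightarrow>\<^sub>M count_space UNIV"
          by (rule measurable_compose[OF measurable_Pair1' T]) simp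
        moreover have "sets (Q \<omega>) = sets R"
          using Q by (intro sets_kernel[OF measurable_prob_algebraD]) auto
        ultimately have T1: "(\<lambda>r. T (\<omega>, r)) \<in> Q \<omega> \<rightarrow>\<^sub>M count_space UNIV"
          by (simp cong: measurable_cong_sets)
        have "(\<lambda>r. indicator {int l} (T (\<omega>, r)) :: ennreal) \<in> borel_measurable (Q \<omega>)"
          by (rule measurable_compose[OF T1]) simp
        then show "(\<integral>\<^sup>+ r. indicator {int l} (T (\<omega>, r)) * c l \<omega> \<partial>Q \<omega>) = ennreal (?t \<omega> l) * c l \<omega>"
          by (simp add: nn_integral_multc jump_prob_eq[OF Q T])
      qed
      finally show "(\<integral>\<^sup>+ \<omega>. ennreal (?t \<omega> l) * c l \<omega> \<partial>P) = (\<integral>\<^sup>+ z. indicator {int l} (T z) * c l (fst z) \<partial>?E)"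
        by simp
    qed simp
    also have "\<dots> = (\<integral>\<^sup>+ z. (\<Sum>l\<le>N. indicator {int l} (T z) * c l (fst z)) \<partial>?E)"
      by (subst nn_integral_sum)
         (use ctm in \<open>simp_all cong: measurable_cong_sets add: sets_extended_law[OF P(1) Q]\<close>)
    \<comment> \<open>At most one \<open>l\<close> equals \<open>T z\<close>, so the sum has at most
      one nonzero term. The inequality gives away the case where \<open>T z\<close> lies outside
      \<open>{0..int N}\<close>.\<close>
    also have "\<dots> \<le> (\<integral>\<^sup>+ z. indicator {i} (fst z (- y + T z)) * g (\<lambda>n. fst z (n - y + T z)) \<partial>?E)"
    proof (rule nn_integral_mono)
      fix z
      show "(\<Sum>l\<le>N. indicator {int l} (T z) * c l (fst z)) \<le>
          indicator {i} (fst z (- y + T z)) * g (\<lambda>n. fst z (n - y + T z))"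
      proof (cases "\<exists>l\<le>N. T z = int l")
        case True
        then obtain k where k: "k \<le> N" "T z = int k" by blast
        have "(\<Sum>l\<le>N. indicator {int l} (T z) * c l (fst z)) = (\<Sum>l\<le>N. if l = k then c k (fst z) else 0)"
          by (rule sum.cong) (auto simp: k indicator_def)
        also have "\<dots> = c k (fst z)" using k by simp
        finally show ?thesis by (simp add: k c_def algebra_simps)
      next
        case False
        then have "(\<Sum>l\<le>N. indicator {int l} (T z) * c l (fst z)) = 0" by (intro sum.neutral) auto
        then show ?thesis by simp
      qed
    qed
    also have "\<dots> = (\<integral>\<^sup>+ \<omega>. h \<omega> * g \<omega> \<partial>P)" using key[OF g] by simp
    finally show ?thesis .
  qed
  have "AE \<omega> in P. f \<omega> \<le> h \<omega>"
  proof (rule AE_le_if_nn_integral_le)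
    show "f \<in> borel_measurable P" "h \<in> borel_measurable P" by measurable
    show "(\<integral>\<^sup>+ \<omega>. f \<omega> * indicator A \<omega> \<partial>P) \<le> (\<integral>\<^sup>+ \<omega>. h \<omega> * indicator A \<omega> \<partial>P)" if "A \<in> sets P" for A
      by (rule le) (use that P(1) in simp)
    \<comment> \<open>For finiteness, \<open>key\<close> with a constant test function turns the
      integral of \<open>h\<close> into a probability.\<close>
    interpret E: prob_space ?E using sol by (rule two_sided_markov_chain_prob_space)
    have "(\<integral>\<^sup>+ \<omega>. h \<omega> \<partial>P) = (\<integral>\<^sup>+ z. indicator {i} (fst z (- y + T z)) \<partial>?E)"
      using key[of "\<lambda>_. 1"] by simp
    also have "\<dots> \<le> (\<integral>\<^sup>+ z. 1 \<partial>?E)" by (intro nn_integral_mono) (auto simp: indicator_def)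
    also have "\<dots> < \<infinity>" by (simp add: E.emeasure_space_1)
    finally show "(\<integral>\<^sup>+ \<omega>. h \<omega> \<partial>P) < \<infinity>" .
  qed
  moreover have "f \<omega> = ennreal (\<Sum>l\<le>N. indicator {i} (\<omega> (y - int l)) * ?t (\<lambda>n. \<omega> (n + (y - int l))) l)" for \<omega>
  proof -
    have "indicator {i} a * ennreal b = ennreal (indicator {i} a * b)" for a b
      by (auto simp: indicator_def)
    then show ?thesis by (simp add: f_def sum_ennreal jump_prob_nonneg)
  qed
  moreover have "0 \<le> site_weight m \<nu> i j" for j
    using m[of i] m[of j] by (simp add: site_weight_def)
  ultimately show ?thesis by (simp add: h_def)
qed

section \<open>Averaging over windows\<close>

text \<open>Exactly one \<open>x\<close> passes the test, the one for the earliest visit to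
  \<open>i\<close> in \<open>{1 - int n..0}\<close>; there is such a visit because the origin is
  one.\<close>

lemma sum_first_occurrence:
  fixes i :: 's and \<omega> :: "int \<Rightarrow> 's"
  assumes "\<omega> 0 = i" and "0 < n"
  shows "(\<Sum>x<n. of_bool (\<omega> (- int x) = i \<and> (\<forall>j\<in>{1 - int n..- 1 - int x}. \<omega> j \<noteq> i)) :: ennreal) = 1"
proof -
  define A where "A = {x. x < n \<and> \<omega> (- int x) = i}"
  have A: "finite A" "A \<noteq> {}" using assms by (auto simp: A_def)
  \<comment> \<open>Positions are negated, so the earliest visit belongs to the largest
    \<open>x\<close>.\<close>
  define x0 where "x0 = Max A"
  have x0: "x0 < n" "\<omega> (- int x0) = i" using Max_in[OF A] by (auto simp: A_def x0_def)
  have iff: "\<omega> (- int x) = i \<and> (\<forall>j\<in>{1 - int n..- 1 - int x}. \<omega> j \<noteq> i) \<longleftrightarrow> x = x0" if "x < n" for x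
  proof
    assume *: "\<omega> (- int x) = i \<and> (\<forall>j\<in>{1 - int n..- 1 - int x}. \<omega> j \<noteq> i)"
    then have "x \<le> x0" using that A by (auto simp: A_def x0_def intro!: Max_ge)
    moreover have "\<not> x < x0"
    proof
      assume "x < x0"
      then have "- int x0 \<in> {1 - int n..- 1 - int x}" using x0 by auto
      then show False using * x0 by blast
    qed
    ultimately show "x = x0" by simp
  next
    assume "x = x0"
    moreover have "\<omega> j \<noteq> i" if j: "j \<in> {1 - int n..- 1 - int x0}" for j
    proof
      assume "\<omega> j = i"
      then have "nat (- j) \<in> A" using j by (auto simp: A_def)
      then have "nat (- j) \<le> x0" unfolding x0_def using A by (intro Max_ge) auto
      then show False using j by auto
    qed
    ultimately show "\<omega> (- int x) = i \<and> (\<forall>j\<in>{1 - int n..- 1 - int x}. \<omega> j \<noteq> i)" using x0 by simp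
  qed
  have "(\<Sum>x<n. of_bool (\<omega> (- int x) = i \<and> (\<forall>j\<in>{1 - int n..- 1 - int x}. \<omega> j \<noteq> i)) :: ennreal) =
      (\<Sum>x<n. if x = x0 then 1 else 0)"
    by (rule sum.cong) (use iff in auto)
  then show ?thesis using x0 by simp
qed

text \<open>Both sides are the measure, under the stationary (infinite) law of the chain divided by
  \<open>m i\<close>, of a sum over the visits to \<open>i\<close> in a window of length \<open>k\<close>. On the right the window is
  recentred at its first visit to \<open>i\<close>, which is why only the law started in \<open>i\<close> is needed.\<close>

lemma window_decomposition:
  fixes p :: "'s::countable \<Rightarrow> 's \<Rightarrow> real" and g :: "nat \<Rightarrow> (int \<Rightarrow> 's) \<Rightarrow> ennreal"
  assumes P: "sets P = sets path_space" "two_sided_markov_chain p m (return_pmf i) P (\<lambda>n \<omega>. \<omega> n)"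
    and m: "\<And>j. 0 < m j" and g: "\<And>z. g z \<in> borel_measurable path_space"
  shows "(\<Sum>z<k. \<integral>\<^sup>+ \<omega>. g z \<omega> \<partial>P) =
    (\<Sum>r<k. \<integral>\<^sup>+ \<omega>. indicator {\<omega>. \<forall>j\<in>{int r + 1 - int k..-1}. \<omega> j \<noteq> i} \<omega> *
      (\<Sum>x\<le>r. indicator {i} (\<omega> (int x)) * g (r - x) (\<lambda>n. \<omega> (n + int x))) \<partial>P)"
proof -
  interpret prob_space P using P(2) by (rule two_sided_markov_chain_prob_space)
  note [measurable_cong] = P(1)
  note g[measurable]
  have gs[measurable]: "(\<lambda>\<omega>. g z (\<lambda>n. \<omega> (n + l))) \<in> borel_measurable path_space" for z l
    by (rule measurable_compose[OF measurable_path_shift g])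
  have avoid[measurable]: "{\<omega>::int \<Rightarrow> 's. \<forall>j\<in>{a..b}. \<omega> j \<noteq> i} \<in> sets path_space" for a b :: int
  proof -
    have "Measurable.pred path_space (\<lambda>\<omega>::int \<Rightarrow> 's. \<forall>j\<in>{a..b}. \<omega> j \<noteq> i)" by measurable
    then show ?thesis by (simp add: pred_def)
  qed
  have start: "AE \<omega> in P. \<omega> 0 = i"
  proof -
    have "AE j in distr P (count_space UNIV) (\<lambda>\<omega>. \<omega> 0). j = i"
      unfolding two_sided_markov_chain_law[OF P(2)] by (simp add: AE_measure_pmf_iff)
    then show ?thesis by (subst (asm) AE_distr_iff) simp_all
  qed
  \<comment> \<open>Here the origin is the source, the window is
    \<open>{int z + 1 - int k..int z}\<close>, and its first visit to \<open>i\<close> is at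
    \<open>- int x\<close>.\<close>
  define F where "F z x = (\<integral>\<^sup>+ \<omega>. indicator {i} (\<omega> (- int x)) *
      (indicator {\<omega>. \<forall>j\<in>{int z + 1 - int k..- 1 - int x}. \<omega> j \<noteq> i} \<omega> * g z \<omega>) \<partial>P)" for z x
  \<comment> \<open>On this side the window is \<open>{int r + 1 - int k..int r}\<close> with its
    first visit at the origin. \<open>point_stationary\<close> moves the origin to the source at
    \<open>int x\<close>, which leaves \<open>r - x\<close> sites of the window after it.\<close>
  have R: "(\<integral>\<^sup>+ \<omega>. indicator {\<omega>. \<forall>j\<in>{int r + 1 - int k..-1}. \<omega> j \<noteq> i} \<omega> *
      (\<Sum>x\<le>r. indicator {i} (\<omega> (int x)) * g (r - x) (\<lambda>n. \<omega> (n + int x))) \<partial>P) = (\<Sum>x\<le>r. F (r - x) x)" for r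
  proof -
    have "(\<integral>\<^sup>+ \<omega>. indicator {\<omega>. \<forall>j\<in>{int r + 1 - int k..-1}. \<omega> j \<noteq> i} \<omega> *
      (\<Sum>x\<le>r. indicator {i} (\<omega> (int x)) * g (r - x) (\<lambda>n. \<omega> (n + int x))) \<partial>P) =
      (\<Sum>x\<le>r. \<integral>\<^sup>+ \<omega>. indicator {\<omega>. \<forall>j\<in>{int r + 1 - int k..-1}. \<omega> j \<noteq> i} \<omega> *
        (indicator {i} (\<omega> (int x)) * g (r - x) (\<lambda>n. \<omega> (n + int x))) \<partial>P)"
      unfolding sum_distrib_left by (rule nn_integral_sum) measurable
    also have "\<dots> = (\<Sum>x\<le>r. F (r - x) x)"
    proof (rule sum.cong)
      fix x assume "x \<in> {..r}"
      then have xr: "int (r - x) = int r - int x" by auto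
      define G where "G \<omega> = indicator {\<omega>. \<forall>j\<in>{int (r - x) + 1 - int k..- 1 - int x}. \<omega> j \<noteq> i} \<omega> * g (r - x) \<omega>"
        for \<omega>
      have Gm: "G \<in> borel_measurable path_space" unfolding G_def by measurable
      have "(\<forall>j\<in>{int (r - x) + 1 - int k..- 1 - int x}. \<omega> (j + int x) \<noteq> i) \<longleftrightarrow>
          (\<forall>j\<in>{int r + 1 - int k..-1}. \<omega> j \<noteq> i)" for \<omega> :: "int \<Rightarrow> 's"
      proof (intro iffI ballI)
        fix j assume *: "\<forall>j\<in>{int (r - x) + 1 - int k..- 1 - int x}. \<omega> (j + int x) \<noteq> i"
          and j: "j \<in> {int r + 1 - int k..-1}"
        have "j - int x \<in> {int (r - x) + 1 - int k..- 1 - int x}" using j xr by auto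
        then have "\<omega> (j - int x + int x) \<noteq> i" using * by blast
        then show "\<omega> j \<noteq> i" by simp
      next
        fix j assume *: "\<forall>j\<in>{int r + 1 - int k..-1}. \<omega> j \<noteq> i"
          and j: "j \<in> {int (r - x) + 1 - int k..- 1 - int x}"
        have "j + int x \<in> {int r + 1 - int k..-1}" using j xr by auto
        then show "\<omega> (j + int x) \<noteq> i" using * by blast
      qed
      then have "(\<integral>\<^sup>+ \<omega>. indicator {\<omega>. \<forall>j\<in>{int r + 1 - int k..-1}. \<omega> j \<noteq> i} \<omega> *
          (indicator {i} (\<omega> (int x)) * g (r - x) (\<lambda>n. \<omega> (n + int x))) \<partial>P) =
        (\<integral>\<^sup>+ \<omega>. indicator {i} (\<omega> (int x)) * G (\<lambda>n. \<omega> (n + int x)) \<partial>P)"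
        by (simp add: G_def indicator_def mult_ac)
      also have "\<dots> = F (r - x) x"
        using point_stationary[OF P m Gm, of "int x"] by (simp add: F_def G_def)
      finally show "(\<integral>\<^sup>+ \<omega>. indicator {\<omega>. \<forall>j\<in>{int r + 1 - int k..-1}. \<omega> j \<noteq> i} \<omega> *
          (indicator {i} (\<omega> (int x)) * g (r - x) (\<lambda>n. \<omega> (n + int x))) \<partial>P) = F (r - x) x" .
    qed simp
    finally show ?thesis .
  qed
  \<comment> \<open>The window contains the origin, a visit to \<open>i\<close>, so summing over the
    position of its first visit restores the whole integral. The range \<open>x < k - z\<close>
    keeps that position inside the window.\<close>
  have L: "(\<integral>\<^sup>+ \<omega>. g z \<omega> \<partial>P) = (\<Sum>x<k - z. F z x)" if "z < k" for z
  proof -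
    have "(\<Sum>x<k - z. F z x) = (\<integral>\<^sup>+ \<omega>. (\<Sum>x<k - z. indicator {i} (\<omega> (- int x)) *
      (indicator {\<omega>. \<forall>j\<in>{int z + 1 - int k..- 1 - int x}. \<omega> j \<noteq> i} \<omega> * g z \<omega>)) \<partial>P)"
      unfolding F_def by (subst nn_integral_sum) simp_all
    also have "\<dots> = (\<integral>\<^sup>+ \<omega>. g z \<omega> \<partial>P)"
    proof (rule nn_integral_cong_AE)
      show "AE \<omega> in P. (\<Sum>x<k - z. indicator {i} (\<omega> (- int x)) *
        (indicator {\<omega>. \<forall>j\<in>{int z + 1 - int k..- 1 - int x}. \<omega> j \<noteq> i} \<omega> * g z \<omega>)) = g z \<omega>"
        using start
      proof (rule AE_mp, intro AE_I2 impI)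
        fix \<omega> :: "int \<Rightarrow> 's" assume "\<omega> 0 = i"
        have eq: "1 - int (k - z) = int z + 1 - int k" using that by auto
        have "(\<Sum>x<k - z. indicator {i} (\<omega> (- int x)) *
            (indicator {\<omega>. \<forall>j\<in>{int z + 1 - int k..- 1 - int x}. \<omega> j \<noteq> i} \<omega> * g z \<omega>)) =
          (\<Sum>x<k - z. of_bool (\<omega> (- int x) = i \<and> (\<forall>j\<in>{1 - int (k - z)..- 1 - int x}. \<omega> j \<noteq> i))) * g z \<omega>"
          unfolding eq sum_distrib_right by (rule sum.cong) (auto simp: indicator_def)
        also have "\<dots> = g z \<omega>"
          using sum_first_occurrence[of \<omega> i "k - z", OF \<open>\<omega> 0 = i\<close>] that by simp
        finally show "(\<Sum>x<k - z. indicator {i} (\<omega> (- int x)) *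
            (indicator {\<omega>. \<forall>j\<in>{int z + 1 - int k..- 1 - int x}. \<omega> j \<noteq> i} \<omega> * g z \<omega>)) = g z \<omega>" .
      qed
    qed
    finally show ?thesis by simp
  qed
  have "(\<Sum>z<k. \<integral>\<^sup>+ \<omega>. g z \<omega> \<partial>P) = (\<Sum>z<k. \<Sum>x<k - z. F z x)" using L by simp
  also have "\<dots> = (\<Sum>r<k. \<Sum>x\<le>r. F (r - x) x)"
    unfolding sum.Sigma[of "{..<k}" "\<lambda>z. {..<k - z}", simplified] sum.Sigma[of "{..<k}" "\<lambda>r. {..r}", simplified]
    by (rule sum.reindex_bij_witness[of _ "\<lambda>(r,x). (r - x, x)" "\<lambda>(z,x). (z + x, x)"]) auto
  finally show ?thesis by (simp only: R)
qed

section \<open>The stopping rule and the comparison of tails\<close>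

text \<open>For positive \<open>m\<close> this is \<open>m i\<close> times the difference between
  the two sides of the inequality in \<open>T_star\<close>.\<close>

definition excess :: "('s \<Rightarrow> real) \<Rightarrow> 's pmf \<Rightarrow> 's \<Rightarrow> (int \<Rightarrow> 's) \<Rightarrow> nat \<Rightarrow> real" where
  "excess m \<nu> i \<omega> n = (\<Sum>k\<le>n. indicator {i} (\<omega> (int k)) - site_weight m \<nu> i (\<omega> (int k)))"

lemma local_time_nat_interval:
  "local_time m \<omega> j {0..int n} = (\<Sum>k\<le>n. of_bool (\<omega> (int k) = j) / m j)"
proof -
  have "{k \<in> {0..int n}. \<omega> k = j} = int ` {k \<in> {..n}. \<omega> (int k) = j}"
  proof (intro set_eqI iffI)
    fix k assume "k \<in> {k \<in> {0..int n}. \<omega> k = j}"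
    then show "k \<in> int ` {k \<in> {..n}. \<omega> (int k) = j}"
      by (intro image_eqI[of _ _ "nat k"]) auto
  qed auto
  then have "card {k \<in> {0..int n}. \<omega> k = j} = card {k \<in> {..n}. \<omega> (int k) = j}"
    by (simp add: card_image)
  moreover have "real (card {k \<in> {..n}. \<omega> (int k) = j}) = (\<Sum>k\<le>n. of_bool (\<omega> (int k) = j))"
    by (simp add: Int_def)
  ultimately have "real (card {k \<in> {0..int n}. \<omega> k = j}) = (\<Sum>k\<le>n. of_bool (\<omega> (int k) = j))"
    by (simp only:)
  then show ?thesis unfolding local_time_def by (simp only: sum_divide_distrib)
qed

text \<open>By integrality of the weights the excess is an integer, so being positive means being at
  least one, the threshold in the matching lemmas.\<close>

lemma local_time_le_iff_excess:
  assumes m: "\<And>j. 0 < m j" and int: "\<And>j. m i / m j * pmf \<nu> j \<in> \<int>"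
  shows "local_time m \<omega> i {0..int n} \<le> (\<Sum>\<^sub>\<infinity>j\<in>UNIV. pmf \<nu> j * local_time m \<omega> j {0..int n})
    \<longleftrightarrow> \<not> 1 \<le> excess m \<nu> i \<omega> n"
proof -
  \<comment> \<open>Only states visited in \<open>{0..int n}\<close> contribute, which makes the
    infinite sum finite.\<close>
  let ?V = "(\<lambda>k. \<omega> (int k)) ` {..n}"
  have "(\<Sum>\<^sub>\<infinity>j\<in>UNIV. pmf \<nu> j * local_time m \<omega> j {0..int n}) =
      (\<Sum>\<^sub>\<infinity>j\<in>?V. pmf \<nu> j * local_time m \<omega> j {0..int n})"
    by (rule infsum_cong_neutral) (auto simp: local_time_nat_interval intro!: sum.neutral)
  also have "\<dots> = (\<Sum>j\<in>?V. \<Sum>k\<le>n. pmf \<nu> j * (of_bool (\<omega> (int k) = j) / m j))"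
    by (simp add: local_time_nat_interval sum_distrib_left)
  also have "\<dots> = (\<Sum>k\<le>n. \<Sum>j\<in>?V. pmf \<nu> j * (of_bool (\<omega> (int k) = j) / m j))"
    by (rule sum.swap)
  also have "\<dots> = (\<Sum>k\<le>n. pmf \<nu> (\<omega> (int k)) / m (\<omega> (int k)))"
  proof (rule sum.cong)
    fix k assume k: "k \<in> {..n}"
    have "(\<Sum>j\<in>?V. pmf \<nu> j * (of_bool (\<omega> (int k) = j) / m j)) =
        (\<Sum>j\<in>?V. if j = \<omega> (int k) then pmf \<nu> j / m j else 0)"
      by (rule sum.cong) auto
    also have "\<dots> = pmf \<nu> (\<omega> (int k)) / m (\<omega> (int k))" using k by (subst sum.delta) auto
    finally show "(\<Sum>j\<in>?V. pmf \<nu> j * (of_bool (\<omega> (int k) = j) / m j)) = pmf \<nu> (\<omega> (int k)) / m (\<omega> (int k))" .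
  qed simp
  finally have S: "m i * (\<Sum>\<^sub>\<infinity>j\<in>UNIV. pmf \<nu> j * local_time m \<omega> j {0..int n}) =
      (\<Sum>k\<le>n. site_weight m \<nu> i (\<omega> (int k)))"
    by (simp add: sum_distrib_left site_weight_def)
  have I: "m i * local_time m \<omega> i {0..int n} = (\<Sum>k\<le>n. indicator {i} (\<omega> (int k)))"
    using m[of i] by (simp add: local_time_nat_interval sum_distrib_left indicator_def of_bool_def)
  have "excess m \<nu> i \<omega> n \<in> \<int>"
    unfolding excess_def using int by (intro Ints_sum Ints_diff) (auto simp: indicator_def site_weight_def)
  then obtain e where e: "excess m \<nu> i \<omega> n = of_int e" by (auto elim: Ints_cases)
  have "local_time m \<omega> i {0..int n} \<le> (\<Sum>\<^sub>\<infinity>j\<in>UNIV. pmf \<nu> j * local_time m \<omega> j {0..int n}) \<longleftrightarrow>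
      m i * local_time m \<omega> i {0..int n} \<le> m i * (\<Sum>\<^sub>\<infinity>j\<in>UNIV. pmf \<nu> j * local_time m \<omega> j {0..int n})"
    using m[of i] by simp
  also have "\<dots> \<longleftrightarrow> excess m \<nu> i \<omega> n \<le> 0"
    unfolding S I by (simp add: excess_def sum_subtractf)
  also have "\<dots> \<longleftrightarrow> \<not> 1 \<le> excess m \<nu> i \<omega> n" unfolding e by auto
  finally show ?thesis .
qed

text \<open>This is \<open>unmatched_le_escaping\<close> along one path, with the kernel read off
  from the path as seen from each source. A source at \<open>x\<close> stays unmatched up to
  \<open>r\<close> when the excess counted from \<open>x\<close> remains at least one
  throughout.\<close>

lemma window_unmatched_le:
  assumes m: "\<And>j. 0 < m j"
    and K: "\<And>\<omega> z. (\<Sum>l\<le>z. K \<omega> l) \<le> (1::real)"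
    and balance: "\<And>y N. (\<Sum>l\<le>N. indicator {i} (\<omega> (y - int l)) * K (\<lambda>n. \<omega> (n + (y - int l))) l)
      \<le> site_weight m \<nu> i (\<omega> y)"
  shows "(\<Sum>x\<le>r. indicator {i} (\<omega> (int x)) * of_bool (\<forall>n\<le>r - x. 1 \<le> excess m \<nu> i (\<lambda>n. \<omega> (n + int x)) n)) \<le>
    (\<Sum>x\<le>r. indicator {i} (\<omega> (int x)) * (1 - (\<Sum>l\<le>r - x. K (\<lambda>n. \<omega> (n + int x)) l)))"
    (is "?L \<le> ?R")
proof -
  define u where "u x = (indicator {i} (\<omega> (int x)) :: real)" for x :: nat
  define b where "b y = site_weight m \<nu> i (\<omega> (int y))" for y :: nat
  define M where "M x l = K (\<lambda>n. \<omega> (n + int x)) l" for x :: nat and l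
  let ?U = "{x. x \<le> r \<and> (\<forall>y\<in>{x..r}. 1 \<le> (\<Sum>k\<in>{x..y}. u k - b k))}"
  have ex: "excess m \<nu> i (\<lambda>n. \<omega> (n + int x)) n = (\<Sum>k\<in>{x..x + n}. u k - b k)" for x n
    unfolding excess_def u_def b_def
    by (rule sum.reindex_bij_witness[of _ "\<lambda>k. k - x" "\<lambda>k. k + x"]) auto
  have U: "(\<forall>n\<le>r - x. 1 \<le> excess m \<nu> i (\<lambda>n. \<omega> (n + int x)) n) \<longleftrightarrow> x \<in> ?U" if "x \<le> r" for x
  proof
    assume *: "\<forall>n\<le>r - x. 1 \<le> excess m \<nu> i (\<lambda>n. \<omega> (n + int x)) n"
    have "1 \<le> (\<Sum>k\<in>{x..y}. u k - b k)" if "y \<in> {x..r}" for y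
    proof -
      have "y - x \<le> r - x" "x + (y - x) = y" using that by auto
      then show ?thesis using *[rule_format, of "y - x"] ex[of x "y - x"] by simp
    qed
    then show "x \<in> ?U" using \<open>x \<le> r\<close> by simp
  next
    assume "x \<in> ?U"
    then show "\<forall>n\<le>r - x. 1 \<le> excess m \<nu> i (\<lambda>n. \<omega> (n + int x)) n"
      using that by (auto simp: ex)
  qed
  have "?L \<le> (\<Sum>x\<le>r. indicator ?U x)"
    by (rule sum_mono) (use U in \<open>auto simp: indicator_def\<close>)
  also have "\<dots> = real (card ?U)"
  proof -
    have "{..r} \<inter> ?U = ?U" by auto
    moreover have "(\<Sum>x\<le>r. indicator V x) = real (card ({..r} \<inter> V))" for V
      by (simp add: indicator_def)
    ultimately show ?thesis by (simp only:)
  qed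
  also have "\<dots> \<le> (\<Sum>x\<le>r. u x * (1 - (\<Sum>l\<le>r - x. M x l)))"
  proof (rule unmatched_le_escaping)
    show "0 \<le> u x" for x by (simp add: u_def)
    show "(\<Sum>l\<le>z. M x l) \<le> 1" for x z using K by (simp add: M_def)
    fix x1 y :: nat
    show "(\<Sum>x\<in>{x1..y}. u x * M x (y - x)) \<le> b y"
    proof (cases "x1 \<le> y")
      case True
      have "(\<Sum>x\<in>{x1..y}. u x * M x (y - x)) =
          (\<Sum>l\<le>y - x1. indicator {i} (\<omega> (int y - int l)) * K (\<lambda>n. \<omega> (n + (int y - int l))) l)"
        unfolding u_def M_def
        by (rule sum.reindex_bij_witness[of _ "\<lambda>l. y - l" "\<lambda>x. y - x"]) (use True in \<open>auto simp: of_nat_diff\<close>)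
      then show ?thesis using balance[where y="int y" and N="y - x1"] by (simp add: b_def)
    next
      case False
      then show ?thesis using m[of i] m[of "\<omega> (int y)"] by (simp add: b_def site_weight_def)
    qed
  qed
  finally show ?thesis by (simp add: u_def M_def)
qed


text \<open>The tails are not compared for a single \<open>z\<close>.
  \<open>window_decomposition\<close> turns the sums over \<open>z\<close> into averages over
  windows, and there the unmatched mass is compared path by path.\<close>

lemma sum_tails_le:
  fixes p :: "'s::countable \<Rightarrow> 's \<Rightarrow> real" and Q :: "(int \<Rightarrow> 's) \<Rightarrow> 'r measure"
  assumes P: "sets P = sets path_space" "two_sided_markov_chain p m (return_pmf i) P (\<lambda>n \<omega>. \<omega> n)"
    and m: "\<And>j. 0 < m j"
    and Q: "Q \<in> path_space \<rightarrow>\<^sub>M prob_algebra R" and T: "T \<in> path_space \<Otimes>\<^sub>M R \<rightarrow>\<^sub>M count_space UNIV"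
    and nonneg: "AE z in extended_law P R Q. 0 \<le> T z"
    and sol: "two_sided_markov_chain p m \<nu> (extended_law P R Q) (\<lambda>n z. fst z (n + T z))"
  shows "(\<Sum>z<k. measure P {\<omega> \<in> space P. \<forall>n\<le>z. 1 \<le> excess m \<nu> i \<omega> n}) \<le>
    (\<Sum>z<k. measure (extended_law P R Q) {x \<in> space (extended_law P R Q). z < nat (T x)})"
proof -
  let ?E = "extended_law P R Q"
  let ?t = "jump_prob Q T"
  interpret P: prob_space P using P(2) by (rule two_sided_markov_chain_prob_space)
  interpret E: prob_space ?E using sol by (rule two_sided_markov_chain_prob_space)
  note [measurable_cong] = P(1)
  have spP: "space P = UNIV" by (rule space_eq_UNIV_path[OF P(1)])
  have TE[measurable]: "T \<in> ?E \<rightarrow>\<^sub>M count_space UNIV"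
    by (subst measurable_cong_sets[OF sets_extended_law[OF P(1) Q] refl]) (rule T)
  have jm[measurable]: "(\<lambda>\<omega>. ?t \<omega> l) \<in> borel_measurable path_space" for l
    by (rule measurable_jump_prob[OF Q T])
  have em[measurable]: "(\<lambda>\<omega>. excess m \<nu> i \<omega> n) \<in> borel_measurable path_space" for n
    unfolding excess_def by measurable
  define B where "B z = {\<omega>. \<forall>n\<le>z. 1 \<le> excess m \<nu> i \<omega> n}" for z
  have B[measurable]: "B z \<in> sets path_space" for z
  proof -
    have "Measurable.pred path_space (\<lambda>\<omega>. \<forall>n\<le>z. 1 \<le> excess m \<nu> i \<omega> n)" by measurable
    then show ?thesis by (simp add: pred_def B_def)
  qed
  \<comment> \<open>\<open>g z\<close> marks the paths on which the stopping rule has not been met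
    by time \<open>z\<close>; \<open>h z\<close> is, for almost every path, the conditional
    probability that \<open>T\<close> exceeds \<open>z\<close>.\<close>
  define g where "g z \<omega> = (indicator (B z) \<omega> :: ennreal)" for z \<omega>
  define h where "h z \<omega> = ennreal (1 - (\<Sum>l\<le>z. ?t \<omega> l))" for z \<omega>
  have g[measurable]: "g z \<in> borel_measurable path_space" for z unfolding g_def by measurable
  have h[measurable]: "h z \<in> borel_measurable path_space" for z unfolding h_def by measurable
  \<comment> \<open>The window bound uses the balance at all sites and for all ranges at once; these
    are countably many conditions.\<close>
  have balance: "AE \<omega> in P. \<forall>y N. (\<Sum>l\<le>N. indicator {i} (\<omega> (y - int l)) * ?t (\<lambda>n. \<omega> (n + (y - int l))) l)
      \<le> site_weight m \<nu> i (\<omega> y)"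
    unfolding AE_all_countable using jump_prob_balance[OF P m Q T sol] by blast
  have "(\<Sum>z<k. \<integral>\<^sup>+ \<omega>. g z \<omega> \<partial>P) \<le> (\<Sum>z<k. \<integral>\<^sup>+ \<omega>. h z \<omega> \<partial>P)"
    unfolding window_decomposition[OF P m g] window_decomposition[OF P m h]
  proof (intro sum_mono nn_integral_mono_AE)
    fix r
    show "AE \<omega> in P. indicator {\<omega>. \<forall>j\<in>{int r + 1 - int k..-1}. \<omega> j \<noteq> i} \<omega> *
        (\<Sum>x\<le>r. indicator {i} (\<omega> (int x)) * g (r - x) (\<lambda>n. \<omega> (n + int x))) \<le>
      indicator {\<omega>. \<forall>j\<in>{int r + 1 - int k..-1}. \<omega> j \<noteq> i} \<omega> *
        (\<Sum>x\<le>r. indicator {i} (\<omega> (int x)) * h (r - x) (\<lambda>n. \<omega> (n + int x)))"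
      using balance
    proof (rule AE_mp, intro AE_I2 impI mult_left_mono)
      fix \<omega> assume bal: "\<forall>y N. (\<Sum>l\<le>N. indicator {i} (\<omega> (y - int l)) * ?t (\<lambda>n. \<omega> (n + (y - int l))) l)
        \<le> site_weight m \<nu> i (\<omega> y)"
      have "(\<Sum>x\<le>r. indicator {i} (\<omega> (int x)) * g (r - x) (\<lambda>n. \<omega> (n + int x))) =
          ennreal (\<Sum>x\<le>r. indicator {i} (\<omega> (int x)) * of_bool (\<forall>n\<le>r - x. 1 \<le> excess m \<nu> i (\<lambda>n. \<omega> (n + int x)) n))"
        by (subst sum_ennreal[symmetric])
          (auto simp: g_def B_def indicator_def ennreal_of_nat_eq_real_of_nat intro!: sum.cong)
      also have "\<dots> \<le> ennreal (\<Sum>x\<le>r. indicator {i} (\<omega> (int x)) * (1 - (\<Sum>l\<le>r - x. ?t (\<lambda>n. \<omega> (n + int x)) l)))"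
        by (intro ennreal_leI window_unmatched_le[OF m sum_jump_prob_le[OF Q T]] bal[rule_format])
      also have "\<dots> = (\<Sum>x\<le>r. indicator {i} (\<omega> (int x)) * h (r - x) (\<lambda>n. \<omega> (n + int x)))"
        by (subst sum_ennreal[symmetric])
          (auto simp: h_def indicator_def sum_jump_prob_le[OF Q T] intro!: sum.cong)
      finally show "(\<Sum>x\<le>r. indicator {i} (\<omega> (int x)) * g (r - x) (\<lambda>n. \<omega> (n + int x))) \<le>
        (\<Sum>x\<le>r. indicator {i} (\<omega> (int x)) * h (r - x) (\<lambda>n. \<omega> (n + int x)))" .
    qed simp
  qed
  moreover have "(\<integral>\<^sup>+ \<omega>. g z \<omega> \<partial>P) = ennreal (measure P {\<omega> \<in> space P. \<forall>n\<le>z. 1 \<le> excess m \<nu> i \<omega> n})" for z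
    using B[of z] by (simp add: g_def[abs_def] P.emeasure_eq_measure B_def spP P(1))
  moreover have "(\<integral>\<^sup>+ \<omega>. h z \<omega> \<partial>P) = ennreal (measure ?E {x \<in> space ?E. z < nat (T x)})" for z
  proof -
    have jE: "(\<integral>\<^sup>+ \<omega>. ennreal (?t \<omega> l) \<partial>P) = ennreal (measure ?E {x \<in> space ?E. T x = int l})" for l
    proof -
      have "(\<lambda>z. indicator {int l} (T z) :: ennreal) \<in> borel_measurable (path_space \<Otimes>\<^sub>M R)"
        by (rule measurable_compose[OF T]) simp
      then have "(\<integral>\<^sup>+ \<omega>. ennreal (?t \<omega> l) \<partial>P) = (\<integral>\<^sup>+ x. indicator {int l} (T x) \<partial>?E)"
        by (simp add: jump_prob_eq[OF Q T] nn_integral_extended_law[OF P(1) Q])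
      also have "\<dots> = (\<integral>\<^sup>+ x. indicator {x \<in> space ?E. T x = int l} x \<partial>?E)"
        by (rule nn_integral_cong) (auto simp: indicator_def)
      finally show ?thesis by (simp add: E.emeasure_eq_measure)
    qed
    have "(\<integral>\<^sup>+ \<omega>. h z \<omega> \<partial>P) = (\<integral>\<^sup>+ \<omega>. 1 - (\<Sum>l\<le>z. ennreal (?t \<omega> l)) \<partial>P)"
      unfolding h_def using sum_jump_prob_le[OF Q T]
      by (intro nn_integral_cong) (simp add: sum_ennreal jump_prob_nonneg ennreal_minus[symmetric] sum_nonneg)
    also have "\<dots> = (\<integral>\<^sup>+ \<omega>. 1 \<partial>P) - (\<integral>\<^sup>+ \<omega>. (\<Sum>l\<le>z. ennreal (?t \<omega> l)) \<partial>P)"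
    proof (rule nn_integral_diff)
      have le: "(\<Sum>l\<le>z. ennreal (?t \<omega> l)) \<le> 1" for \<omega>
        using sum_jump_prob_le[OF Q T, of \<omega> z] by (simp add: sum_ennreal jump_prob_nonneg)
      then show "AE \<omega> in P. (\<Sum>l\<le>z. ennreal (?t \<omega> l)) \<le> 1" by simp
      have "(\<integral>\<^sup>+ \<omega>. (\<Sum>l\<le>z. ennreal (?t \<omega> l)) \<partial>P) \<le> (\<integral>\<^sup>+ \<omega>. 1 \<partial>P)"
        by (rule nn_integral_mono) (rule le)
      then show "(\<integral>\<^sup>+ \<omega>. (\<Sum>l\<le>z. ennreal (?t \<omega> l)) \<partial>P) \<noteq> \<infinity>"
        by (auto simp: P.emeasure_space_1 top_unique)
    qed measurable
    also have "\<dots> = 1 - ennreal (\<Sum>l\<le>z. measure ?E {x \<in> space ?E. T x = int l})"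
      by (simp add: nn_integral_sum jE P.emeasure_space_1 sum_ennreal)
    also have "(\<Sum>l\<le>z. measure ?E {x \<in> space ?E. T x = int l}) =
        measure ?E (\<Union>l\<le>z. {x \<in> space ?E. T x = int l})"
      by (rule E.finite_measure_finite_Union[symmetric]) (auto simp: disjoint_family_on_def)
    \<comment> \<open>Nonnegativity of \<open>T\<close> enters here: almost surely,
      \<open>nat (T x) \<le> z\<close> means that \<open>T x\<close> is one of the integers from 0
      to \<open>z\<close>.\<close>
    also have "\<dots> = measure ?E (space ?E - {x \<in> space ?E. z < nat (T x)})"
    proof (rule measure_eq_AE)
      have U: "x \<in> (\<Union>l\<le>z. {x \<in> space ?E. T x = int l}) \<longleftrightarrow> x \<in> space ?E - {x \<in> space ?E. z < nat (T x)}"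
        if "0 \<le> T x" for x
        using that by (auto intro!: bexI[of _ "nat (T x)"])
      show "AE x in ?E. x \<in> (\<Union>l\<le>z. {x \<in> space ?E. T x = int l}) \<longleftrightarrow>
          x \<in> space ?E - {x \<in> space ?E. z < nat (T x)}"
        using nonneg by (rule AE_mp) (rule AE_I2, use U in blast)
    qed measurable
    also have "\<dots> = 1 - measure ?E {x \<in> space ?E. z < nat (T x)}"
      by (rule E.prob_compl) measurable
    also have "1 - ennreal (1 - measure ?E {x \<in> space ?E. z < nat (T x)}) =
        ennreal (measure ?E {x \<in> space ?E. z < nat (T x)})"
      by (subst ennreal_1[symmetric], subst ennreal_minus) simp_all
    finally show ?thesis .
  qed
  ultimately show ?thesis
    by (simp add: sum_ennreal ennreal_le_iff sum_nonneg)
qed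

theorem theorem4:
  fixes p :: "'s::countable \<Rightarrow> 's \<Rightarrow> real" and m :: "'s \<Rightarrow> real" and i :: 's
    and \<nu> :: "'s pmf" and P :: "(int \<Rightarrow> 's) measure"
    and R :: "'r measure" and Q :: "(int \<Rightarrow> 's) \<Rightarrow> 'r measure"
    and T :: "(int \<Rightarrow> 's) \<times> 'r \<Rightarrow> int" and \<psi> :: "nat \<Rightarrow> real"
  assumes "transition_matrix p" and "irreducible_matrix p" and "recurrent_matrix p"
    and "stationary_measure p m"
    and "sets P = sets path_space"
    and "two_sided_markov_chain p m (return_pmf i) P (\<lambda>n \<omega>. \<omega> n)"
    and "pmf \<nu> i = 0" and "\<And>j. m i / m j * pmf \<nu> j \<in> \<int>"
    and "Q \<in> path_space \<rightarrow>\<^sub>M prob_algebra R"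
    and "T \<in> path_space \<Otimes>\<^sub>M R \<rightarrow>\<^sub>M count_space UNIV"
    and "AE z in extended_law P R Q. 0 \<le> T z"
    and "two_sided_markov_chain p m \<nu> (extended_law P R Q) (\<lambda>n z. fst z (n + T z))"
    and "\<And>n. 0 \<le> \<psi> n" and "concave_nat \<psi>"
  shows "(\<integral>\<^sup>+ \<omega>. ennreal (\<psi> (T_star m \<nu> i \<omega>)) \<partial>P)
           \<le> (\<integral>\<^sup>+ z. ennreal (\<psi> (nat (T z))) \<partial>extended_law P R Q)"
proof -
  let ?E = "extended_law P R Q"
  have m: "0 < m j" for j using assms(4) by (simp add: stationary_measure_def)
  interpret P: prob_space P using assms(6) by (rule two_sided_markov_chain_prob_space)
  interpret E: prob_space ?E using assms(12) by (rule two_sided_markov_chain_prob_space)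
  note [measurable_cong] = assms(5)
  have spP: "space P = UNIV" by (rule space_eq_UNIV_path[OF assms(5)])
  have TE[measurable]: "T \<in> ?E \<rightarrow>\<^sub>M count_space UNIV"
    by (subst measurable_cong_sets[OF sets_extended_law[OF assms(5,9)] refl]) (rule assms(10))
  have em[measurable]: "(\<lambda>\<omega>. excess m \<nu> i \<omega> n) \<in> borel_measurable path_space" for n
    unfolding excess_def by measurable
  define A where "A z = {\<omega> \<in> space P. \<forall>n\<le>z. 1 \<le> excess m \<nu> i \<omega> n}" for z
  have A[measurable]: "A z \<in> P.events" for z unfolding A_def by measurable
  define q where "q z = measure ?E {x \<in> space ?E. z < nat (T x)}" for z
  have tails: "(\<Sum>z<k. measure P (A z)) \<le> (\<Sum>z<k. q z)" for k
    unfolding A_def q_def by (rule sum_tails_le[OF assms(5,6) m assms(9-12)])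
  \<comment> \<open>\<open>T\<close> takes integer values everywhere, so its tails vanish.\<close>
  have q0: "q \<longlonglongrightarrow> 0"
  proof -
    have "(\<lambda>z. measure ?E {x \<in> space ?E. z < nat (T x)}) \<longlonglongrightarrow> measure ?E (\<Inter>z. {x \<in> space ?E. z < nat (T x)})"
      by (rule E.finite_Lim_measure_decseq) (auto simp: decseq_def)
    moreover have "(\<Inter>z. {x \<in> space ?E. z < nat (T x)}) = {}" by auto
    ultimately show ?thesis by (simp add: q_def[abs_def])
  qed
  \<comment> \<open>On \<open>N\<close> no time meets the stopping rule, so that
    \<open>T_star\<close> is unspecified there.\<close>
  define N where "N = (\<Inter>z. A z)"
  have Nm[measurable]: "N \<in> P.events" unfolding N_def by measurable
  \<comment> \<open>If \<open>N\<close> had positive mass, the left side of \<open>tails\<close>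
    would grow at least linearly with slope \<open>measure P N\<close>, while beyond
    \<open>Z\<close> the right side grows with at most half that slope.\<close>
  have "measure P N = 0"
  proof (rule ccontr)
    assume "measure P N \<noteq> 0"
    then have c: "0 < measure P N" by (simp add: zero_less_measure_iff)
    obtain Z where Z: "q z < measure P N / 2" if "z \<ge> Z" for z
      using order_tendstoD(2)[OF q0, of "measure P N / 2"] c by (auto simp: eventually_sequentially)
    have bound: "real k * measure P N \<le> real Z + real k * (measure P N / 2)" for k
    proof -
      have "measure P N \<le> measure P (A z)" for z
        by (rule P.finite_measure_mono) (auto simp: N_def)
      then have "real k * measure P N \<le> (\<Sum>z<k. measure P (A z))"
        using sum_bounded_below[of "{..<k}" "measure P N" "\<lambda>z. measure P (A z)"] by simp
      also have "\<dots> \<le> (\<Sum>z<k. q z)" by (rule tails)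
      also have "\<dots> \<le> (\<Sum>z<k. of_bool (z < Z) + measure P N / 2)"
      proof (rule sum_mono)
        fix z
        have "q z \<le> 1" by (simp add: q_def)
        then show "q z \<le> of_bool (z < Z) + measure P N / 2"
          using Z[of z] c by (cases "z < Z") auto
      qed
      also have "\<dots> = real (card ({..<k} \<inter> {z. z < Z})) + real k * (measure P N / 2)"
        by (simp add: sum.distrib)
      also have "card ({..<k} \<inter> {z. z < Z}) \<le> card {..<Z}"
        by (rule card_mono) auto
      finally show ?thesis by simp
    qed
    obtain k :: nat where "real Z < real k * (measure P N / 2)"
      using reals_Archimedean3[of "measure P N / 2"] c by auto
    then show False using bound[of k] by simp
  qed
  then have "AE \<omega> in P. \<omega> \<notin> N"
    by (intro AE_not_in) (simp add: null_setsI P.emeasure_eq_measure)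
  have star: "T_star m \<nu> i \<omega> = (LEAST n. \<not> 1 \<le> excess m \<nu> i \<omega> n)" for \<omega>
    unfolding T_star_def local_time_le_iff_excess[OF m assms(8)] ..
  have star_tail: "z < T_star m \<nu> i \<omega> \<longleftrightarrow> \<omega> \<in> A z" if notN: "\<omega> \<notin> N" for \<omega> z
  proof -
    \<comment> \<open>Off \<open>N\<close> the rule is met at some time, so the least such time
      meets it too.\<close>
    obtain n where n: "\<not> 1 \<le> excess m \<nu> i \<omega> n" using notN unfolding N_def A_def spP by blast
    show ?thesis
    proof
      assume "z < T_star m \<nu> i \<omega>"
      then have "1 \<le> excess m \<nu> i \<omega> n" if "n \<le> z" for n
        using not_less_Least[of n "\<lambda>n. \<not> 1 \<le> excess m \<nu> i \<omega> n"] that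
        unfolding star[symmetric] by linarith
      then show "\<omega> \<in> A z" unfolding A_def spP by blast
    next
      assume "\<omega> \<in> A z"
      then have "1 \<le> excess m \<nu> i \<omega> (T_star m \<nu> i \<omega>)" if "T_star m \<nu> i \<omega> \<le> z"
        using that unfolding A_def by blast
      moreover have "\<not> 1 \<le> excess m \<nu> i \<omega> (T_star m \<nu> i \<omega>)" unfolding star using n by (rule LeastI)
      ultimately show "z < T_star m \<nu> i \<omega>" by (metis not_le)
    qed
  qed
  have "measure P {\<omega> \<in> space P. z < T_star m \<nu> i \<omega>} = measure P (A z)" for z
  proof (rule measure_eq_AE)
    show "AE \<omega> in P. \<omega> \<in> {\<omega> \<in> space P. z < T_star m \<nu> i \<omega>} \<longleftrightarrow> \<omega> \<in> A z"
      using \<open>AE \<omega> in P. \<omega> \<notin> N\<close> by (rule AE_mp) (rule AE_I2, simp add: star_tail)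
    show "{\<omega> \<in> space P. z < T_star m \<nu> i \<omega>} \<in> P.events" unfolding star by measurable
  qed (rule A)
  then show ?thesis
    using tails
    by (intro nn_integral_concave_mono[OF P.prob_space_axioms E.prob_space_axioms _ _ _ assms(14,13)])
      (simp_all add: star[abs_def] q_def)
qed

end
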